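(* Let $D$ be a finite set of $n\geq 3$ dots in general position in the Euclidean plane or in the round sphere, and let $k,\ell\geq 1$ be integers with $k+\ell=n$. Then the number of (unordered) partitions of $D$ into two non-empty subsets of size $k$ and $\ell$ which can be separated by a circle is \[ \begin{cases} 2k\ell-k-\ell+2 & \text{if } k\neq \ell,\\ k^2-k+1 & \text{if } k=\ell.\end{cases} \]
   Context: "Dots" are the points of a distinguished finite set $D$. A circle in the sphere is the intersection of the sphere with a plane of the ambient $\mathbb{R}^3$ meeting the sphere in more than one point (great circles included); a circle in the plane is an ordinary Euclidean circle of positive radius (lines are not circles). Dots in the sphere are in general position if no four of them lie on a circle; dots in the plane are in general position if no four of them lie on a circle and no three of them lie on a line. The two sides of a circle are the two connected components of its complement. A partition $D=A\sqcup B$ can be separated by a circle if there is a circle passing through none of the dots such that $A$ is the set of dots on one side and $B$ is the set of dots on the other side (either part may be on either side). *)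

theory Defs
  imports "HOL-Analysis.Analysis" "HOL-Library.Disjoint_Sets"
begin

definition plane_circles :: "(real ^ 2) set set" where
  "plane_circles = {sphere c \<rho> | c \<rho>. 0 < \<rho>}"

definition sphere_circles :: "real ^ 3 \<Rightarrow> real \<Rightarrow> (real ^ 3) set set" where
  "sphere_circles a r =
     {sphere a r \<inter> P | P. affine P \<and> aff_dim P = 2 \<and>
        (\<exists>x\<in>sphere a r \<inter> P. \<exists>y\<in>sphere a r \<inter> P. x \<noteq> y)}"

definition no_four_on_circle :: "'a set set \<Rightarrow> 'a set \<Rightarrow> bool" where
  "no_four_on_circle \<C> D \<longleftrightarrow>
     (\<forall>F. F \<subseteq> D \<and> card F = 4 \<longrightarrow> \<not> (\<exists>C\<in>\<C>. F \<subseteq> C))"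

definition general_position_plane :: "(real ^ 2) set \<Rightarrow> bool" where
  "general_position_plane D \<longleftrightarrow>
     no_four_on_circle plane_circles D \<and>
     (\<forall>T. T \<subseteq> D \<and> card T = 3 \<longrightarrow> \<not> collinear T)"

definition general_position_sphere :: "real ^ 3 \<Rightarrow> real \<Rightarrow> (real ^ 3) set \<Rightarrow> bool" where
  "general_position_sphere a r D \<longleftrightarrow> no_four_on_circle (sphere_circles a r) D"

text \<open>
  \<open>X\<close> is the surface containing the dots and \<open>\<C>\<close> its family of circles. The two sides
  \<open>U\<close>, \<open>V\<close> are unordered, so the relation is symmetric in \<open>A\<close> and \<open>B\<close>.
\<close>

definition separated_by_circle ::
    "'a::topological_space set \<Rightarrow> 'a set set \<Rightarrow> 'a set \<Rightarrow> 'a set \<Rightarrow> 'a set \<Rightarrow> bool" where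
  "separated_by_circle X \<C> D A B \<longleftrightarrow>
     (\<exists>C\<in>\<C>. C \<inter> D = {} \<and>
        (\<exists>U V. U \<noteq> V \<and> components (X - C) = {U, V} \<and> A = D \<inter> U \<and> B = D \<inter> V))"

text \<open>
  An unordered partition into two parts is the set \<open>{A, B}\<close> of its parts, so exchanging the
  parts is not counted twice when \<open>k = l\<close>; \<^const>\<open>partition_on\<close> requires the parts to be
  non-empty.
\<close>

definition separable_partitions ::
    "'a::topological_space set \<Rightarrow> 'a set set \<Rightarrow> 'a set \<Rightarrow> nat \<Rightarrow> nat \<Rightarrow> 'a set set set" where
  "separable_partitions X \<C> D k l =
     {{A, B} | A B. A \<noteq> B \<and> partition_on D {A, B} \<and> card A = k \<and> card B = l \<and>
        separated_by_circle X \<C> D A B}"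

end

theory Submission imports Defs begin

text \<open>
  Circles are made linear by lifting the dots to vectors \<open>v i\<close> in \<open>\<real>\<^sup>4\<close>: a point \<open>x\<close> of a sphere goes to
  \<open>(x, 1)\<close>, and a point \<open>x\<close> of the plane to \<open>((x, x \<bullet> x), 1)\<close>, on a paraboloid. Then the two sides of a
  circle are where a linear functional is positive and where it is negative. General position says that
  any four of the vectors are independent, and as spheres and paraboloids are strictly convex, there is
  for each dot a functional (a tangent plane) that is zero at this dot and negative at all others. These
  two properties determine the number of separable partitions, for plane and sphere alike.

  Let \<open>N\<^sub>D(z, k)\<close> be the number of sign patterns of functionals on \<open>D\<close> with \<open>z\<close> zeros and \<open>k\<close> plus
  signs. Deleting a dot and asking in how many ways a pattern of the others extends to it leads to
  (\<open>cuts_deletion\<close>)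
  \<open>(n - z - k) N\<^sub>D(z, k) + (k + 1) N\<^sub>D(z, k + 1) = (\<Sum>p\<in>D. N\<^sub>D\<^sub>-\<^sub>p(z, k)) + (z + 1) N\<^sub>D(z + 1, k)\<close>.
  By general position \<open>N\<^sub>D(4, k) = 0\<close> for \<open>n \<ge> 5\<close>, and by convexity \<open>N\<^sub>D(0, 0) = N\<^sub>D(0, n) = 1\<close> and
  \<open>N\<^sub>D(1, 0) = N\<^sub>D(1, n - 1) = n\<close>.

  These equations determine all \<open>N\<^sub>D(z, k)\<close> with \<open>z \<le> 3\<close> by induction on \<open>n\<close>, starting from \<open>n = 4\<close>, where
  all patterns occur. To see this, combine the differences of two solutions into the forms
  \<open>\<Delta>\<^sub>z(x, y) = \<Sum>k. d(z, k) x\<^sup>k y\<^sup>m\<close> with \<open>m = n - z - k\<close>. The recursion says that the derivative in direction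
  \<open>(1, 1)\<close> maps \<open>\<Delta>\<^sub>z\<close> to \<open>(z + 1) \<Delta>\<close> with index \<open>z + 1\<close>. So \<open>\<Delta>\<^sub>0\<close> is a cubic polynomial on each line in this
  direction, and the boundary values say that it vanishes together with its derivative where the line
  meets \<open>x = 0\<close> and where it meets \<open>y = 0\<close>. Hence it is zero. The lemma \<open>deletion_recursion_kernel\<close> carries
  this out for the coefficients. It remains to observe that explicit quadratic expressions in \<open>k\<close> solve
  the recursion (\<open>expected_cuts_recursion\<close>); the one for \<open>z = 0\<close> is \<open>2 k (n - k) - n + 2\<close>. It counts
  ordered partitions, which for \<open>k = l\<close> means every unordered one twice.

  On the topological side, the two sign regions have to be identified with the components of the
  complement of a circle. This amounts to their connectedness (\<open>connected_spherical_cap\<close>,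
  \<open>components_complement_sphere\<close>). In the plane, separating lines also have to be replaced by circles, which is
  done by a small perturbation.
\<close>

section \<open>Sign patterns of functionals and deletion of a dot\<close>

text \<open>
  Side conditions of a circle are recorded as sign patterns of a linear functional on vectors
  \<open>v i\<close>: the dots in \<open>Z\<close> lie on the circle, those in \<open>A\<close> on its positive side, all others on its
  negative side. Patterns with \<open>Z \<noteq> {}\<close> enter the counting although the final answer only concerns
  \<open>Z = {}\<close>.
\<close>

definition sign_cut :: "('i \<Rightarrow> 'e::real_inner) \<Rightarrow> 'i set \<Rightarrow> 'i set \<Rightarrow> 'i set \<Rightarrow> bool" where
  "sign_cut v D Z A \<longleftrightarrow>
     (\<exists>u. (\<forall>i\<in>Z. u \<bullet> v i = 0) \<and> (\<forall>i\<in>A. 0 < u \<bullet> v i) \<and> (\<forall>i\<in>D - Z - A. u \<bullet> v i < 0))"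

definition cuts :: "('i \<Rightarrow> 'e::real_inner) \<Rightarrow> 'i set \<Rightarrow> nat \<Rightarrow> nat \<Rightarrow> ('i set \<times> 'i set) set" where
  "cuts v D z k =
     {(Z, A). Z \<subseteq> D \<and> A \<subseteq> D - Z \<and> card Z = z \<and> card A = k \<and> sign_cut v D Z A}"

lemma finite_cuts: "finite D \<Longrightarrow> finite (cuts v D z k)"
  by (rule finite_subset[of _ "Pow D \<times> Pow D"]) (auto simp: cuts_def)

lemma small_perturbation:
  fixes f g :: "'i \<Rightarrow> real"
  assumes "finite D"
  shows "\<exists>\<epsilon>>0. \<forall>i\<in>D. f i \<noteq> 0 \<longrightarrow> \<epsilon> * \<bar>g i\<bar> < \<bar>f i\<bar>"
  using assms
proof (induction D)
  case empty
  show ?case by (intro exI[of _ 1]) auto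
next
  case (insert j D)
  then obtain \<epsilon> where \<epsilon>: "\<epsilon> > 0" "\<forall>i\<in>D. f i \<noteq> 0 \<longrightarrow> \<epsilon> * \<bar>g i\<bar> < \<bar>f i\<bar>"
    by blast
  define \<eta> where "\<eta> = (if f j = 0 then \<epsilon> else min \<epsilon> (\<bar>f j\<bar> / (\<bar>g j\<bar> + 1)))"
  have \<eta>: "0 < \<eta>" "\<eta> \<le> \<epsilon>"
    using \<epsilon>(1) by (auto simp: \<eta>_def)
  have "\<eta> * \<bar>g i\<bar> < \<bar>f i\<bar>" if "i \<in> D" "f i \<noteq> 0" for i
    using \<epsilon>(2) that \<eta> mult_right_mono[OF \<eta>(2), of "\<bar>g i\<bar>"] by fastforce
  moreover have "\<eta> * \<bar>g j\<bar> < \<bar>f j\<bar>" if "f j \<noteq> 0"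
  proof -
    have "\<eta> * \<bar>g j\<bar> < \<eta> * (\<bar>g j\<bar> + 1)"
      using \<eta> by simp
    also have "\<dots> \<le> \<bar>f j\<bar> / (\<bar>g j\<bar> + 1) * (\<bar>g j\<bar> + 1)"
      using that by (intro mult_right_mono) (auto simp: \<eta>_def)
    also have "\<dots> = \<bar>f j\<bar>" by simp
    finally show ?thesis .
  qed
  ultimately show ?case
    using \<eta>(1) by (intro exI[of _ \<eta>]) auto
qed

text \<open>
  A circle through \<open>p\<close> can be pushed off \<open>p\<close> to either side, keeping its other incidences, by adding
  a small multiple of a functional \<open>e\<close> that vanishes on \<open>Z\<close> but not at \<open>p\<close>.
\<close>

lemma sign_cut_perturb:
  fixes v :: "'i \<Rightarrow> 'e::real_inner"
  assumes "finite D" and "p \<in> D" and A: "A \<subseteq> D - insert p Z"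
    and e: "\<forall>i\<in>Z. e \<bullet> v i = 0" "0 < e \<bullet> v p"
    and cut: "sign_cut v D (insert p Z) A"
  shows "sign_cut v D Z A" and "sign_cut v D Z (insert p A)"
proof -
  obtain u where u: "\<forall>i\<in>insert p Z. u \<bullet> v i = 0" "\<forall>i\<in>A. 0 < u \<bullet> v i"
      "\<forall>i\<in>D - insert p Z - A. u \<bullet> v i < 0"
    using cut by (auto simp: sign_cut_def)
  obtain \<epsilon> where \<epsilon>: "\<epsilon> > 0" "\<forall>i\<in>D. u \<bullet> v i \<noteq> 0 \<longrightarrow> \<epsilon> * \<bar>e \<bullet> v i\<bar> < \<bar>u \<bullet> v i\<bar>"
    using small_perturbation[OF assms(1), of "\<lambda>i. u \<bullet> v i" "\<lambda>i. e \<bullet> v i"] by blast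
  have pos: "\<epsilon> * \<bar>e \<bullet> v i\<bar> < u \<bullet> v i" if "i \<in> A" for i
    using \<epsilon>(2) u(2) A that by force
  have neg: "\<epsilon> * \<bar>e \<bullet> v i\<bar> < - (u \<bullet> v i)" if "i \<in> D - insert p Z - A" for i
    using \<epsilon>(2) u(3) that by force
  have b: "\<epsilon> * (e \<bullet> v i) \<le> \<epsilon> * \<bar>e \<bullet> v i\<bar>" "- (\<epsilon> * (e \<bullet> v i)) \<le> \<epsilon> * \<bar>e \<bullet> v i\<bar>" for i
    using \<epsilon>(1) by (auto simp: abs_if)
  have ep: "0 < \<epsilon> * (e \<bullet> v p)"
    using \<epsilon>(1) e(2) by simp
  show "sign_cut v D Z A"
    unfolding sign_cut_def
  proof (intro exI[of _ "u - \<epsilon> *\<^sub>R e"] conjI ballI)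
    fix i assume "i \<in> Z" then show "(u - \<epsilon> *\<^sub>R e) \<bullet> v i = 0"
      using u(1) e(1) by (simp add: inner_diff_left)
  next
    fix i assume "i \<in> A" then show "0 < (u - \<epsilon> *\<^sub>R e) \<bullet> v i"
      using pos[of i] b(1)[of i] by (simp add: inner_diff_left)
  next
    fix i assume i: "i \<in> D - Z - A"
    then show "(u - \<epsilon> *\<^sub>R e) \<bullet> v i < 0"
      using neg[of i] b(2)[of i] ep u(1) by (cases "i = p") (auto simp: inner_diff_left)
  qed
  show "sign_cut v D Z (insert p A)"
    unfolding sign_cut_def
  proof (intro exI[of _ "u + \<epsilon> *\<^sub>R e"] conjI ballI)
    fix i assume "i \<in> Z" then show "(u + \<epsilon> *\<^sub>R e) \<bullet> v i = 0"
      using u(1) e(1) by (simp add: inner_add_left)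
  next
    fix i assume "i \<in> insert p A" then show "0 < (u + \<epsilon> *\<^sub>R e) \<bullet> v i"
      using pos[of i] b(2)[of i] ep u(1) by (cases "i = p") (auto simp: inner_add_left)
  next
    fix i assume i: "i \<in> D - Z - insert p A"
    then show "(u + \<epsilon> *\<^sub>R e) \<bullet> v i < 0"
      using neg[of i] b(1)[of i] by (auto simp: inner_add_left)
  qed
qed

text \<open>
  Conversely, two functionals that differ only in the sign at \<open>p\<close> have a positive combination
  vanishing at \<open>p\<close>, and signs on which both agree are kept.
\<close>

lemma sign_cut_between:
  fixes v :: "'i \<Rightarrow> 'e::real_inner"
  assumes "p \<in> D" "p \<notin> Z" "p \<notin> A" "sign_cut v D Z A" "sign_cut v D Z (insert p A)"
  shows "sign_cut v D (insert p Z) A"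
proof -
  obtain u where u: "\<forall>i\<in>Z. u \<bullet> v i = 0" "\<forall>i\<in>A. 0 < u \<bullet> v i" "\<forall>i\<in>D - Z - A. u \<bullet> v i < 0"
    using assms(4) by (auto simp: sign_cut_def)
  obtain w where w: "\<forall>i\<in>Z. w \<bullet> v i = 0" "\<forall>i\<in>insert p A. 0 < w \<bullet> v i"
      "\<forall>i\<in>D - Z - insert p A. w \<bullet> v i < 0"
    using assms(5) by (auto simp: sign_cut_def)
  define a where "a = w \<bullet> v p"
  define b where "b = - (u \<bullet> v p)"
  have ab: "a > 0" "b > 0"
    using u w assms(1-3) by (auto simp: a_def b_def)
  have *: "(a *\<^sub>R u + b *\<^sub>R w) \<bullet> v i = a * (u \<bullet> v i) + b * (w \<bullet> v i)" for i
    by (simp add: inner_add_left)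
  show ?thesis
    unfolding sign_cut_def
  proof (intro exI[of _ "a *\<^sub>R u + b *\<^sub>R w"] conjI ballI)
    fix i assume "i \<in> insert p Z" then show "(a *\<^sub>R u + b *\<^sub>R w) \<bullet> v i = 0"
      using u(1) w(1) unfolding * by (auto simp: a_def b_def)
  next
    fix i assume "i \<in> A" then show "0 < (a *\<^sub>R u + b *\<^sub>R w) \<bullet> v i"
      using u(2) w(2) ab unfolding * by (simp add: add_pos_pos)
  next
    fix i assume "i \<in> D - insert p Z - A"
    then have "u \<bullet> v i < 0" "w \<bullet> v i < 0" using u(3) w(3) by auto
    then show "(a *\<^sub>R u + b *\<^sub>R w) \<bullet> v i < 0"
      using ab unfolding * by (intro add_neg_neg mult_pos_neg)
  qed
qed

lemma sign_cut_extend: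
  fixes v :: "'i \<Rightarrow> 'e::real_inner"
  assumes "p \<in> D" "sign_cut v (D - {p}) Z A"
  shows "sign_cut v D Z A \<or> sign_cut v D Z (insert p A) \<or> sign_cut v D (insert p Z) A"
proof -
  obtain u where u: "\<forall>i\<in>Z. u \<bullet> v i = 0" "\<forall>i\<in>A. 0 < u \<bullet> v i"
      "\<forall>i\<in>D - {p} - Z - A. u \<bullet> v i < 0"
    using assms(2) by (auto simp: sign_cut_def)
  consider "u \<bullet> v p < 0" | "u \<bullet> v p > 0" | "u \<bullet> v p = 0" by linarith
  then show ?thesis
  proof cases
    case 1
    then have "sign_cut v D Z A"
      unfolding sign_cut_def using u by (intro exI[of _ u]) auto
    then show ?thesis by blast
  next
    case 2
    then have "sign_cut v D Z (insert p A)"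
      unfolding sign_cut_def using u by (intro exI[of _ u]) auto
    then show ?thesis by blast
  next
    case 3
    then have "sign_cut v D (insert p Z) A"
      unfolding sign_cut_def using u by (intro exI[of _ u]) auto
    then show ?thesis by blast
  qed
qed

lemma sign_cut_restrict:
  assumes "p \<notin> Z" "p \<notin> A"
  shows "sign_cut v D Z A \<Longrightarrow> sign_cut v (D - {p}) Z A"
    and "sign_cut v D Z (insert p A) \<Longrightarrow> sign_cut v (D - {p}) Z A"
  using assms unfolding sign_cut_def by (blast)+

lemma sum_card_cuts_containing:
  assumes "finite D"
    and "\<And>Z A. (Z, A) \<in> cuts v D z k \<Longrightarrow> card {p \<in> D. R p (Z, A)} = c"
  shows "(\<Sum>p\<in>D. card {c \<in> cuts v D z k. R p c}) = c * card (cuts v D z k)"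
  by (rule sum_multicount) (use assms finite_cuts in auto)

text \<open>
  The recursion that drives the count. Fix \<open>p\<close> and a pattern \<open>(Z, A)\<close> on the other dots. It extends
  to \<open>p\<close> with sign minus, or plus, or both; and it extends both ways exactly if it also extends with
  \<open>p\<close> on the circle. So, for each \<open>p\<close>, the patterns with \<open>p\<close> negative together with those with \<open>p\<close>
  positive are as many as the patterns of \<open>D - {p}\<close> together with those of \<open>D\<close> with \<open>p\<close> zero. Summing
  over \<open>p\<close> counts each pattern once per negative, positive or zero dot, respectively.
\<close>

lemma cuts_deletion:
  fixes v :: "'i \<Rightarrow> 'e::real_inner"
  assumes fin: "finite D"
    and interp: "\<And>Z p. \<lbrakk>Z \<subseteq> D; card Z = z; p \<in> D - Z\<rbrakk> \<Longrightarrow> \<exists>e. (\<forall>i\<in>Z. e \<bullet> v i = 0) \<and> 0 < e \<bullet> v p"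
  shows "(card D - z - k) * card (cuts v D z k) + Suc k * card (cuts v D z (Suc k)) =
     (\<Sum>p\<in>D. card (cuts v (D - {p}) z k)) + Suc z * card (cuts v D (Suc z) k)"
proof -
  let ?X = "\<lambda>p. {c \<in> cuts v D z k. p \<notin> fst c \<union> snd c}"
  let ?Y = "\<lambda>p. {c \<in> cuts v D z (Suc k). p \<in> snd c}"
  let ?W = "\<lambda>p. {c \<in> cuts v D (Suc z) k. p \<in> fst c}"
  have finsub: "finite S" if "S \<subseteq> D" for S using fin that by (rule rev_finite_subset)
  have X: "(\<Sum>p\<in>D. card (?X p)) = (card D - z - k) * card (cuts v D z k)"
  proof (rule sum_card_cuts_containing[OF fin])
    fix Z A assume "(Z, A) \<in> cuts v D z k"
    then have *: "Z \<subseteq> D" "A \<subseteq> D - Z" "card Z = z" "card A = k" by (auto simp: cuts_def)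
    have "{p \<in> D. p \<notin> fst (Z, A) \<union> snd (Z, A)} = D - Z - A" by auto
    also have "card \<dots> = card D - z - k"
      using * finsub by (simp add: card_Diff_subset finite_subset)
    finally show "card {p \<in> D. p \<notin> fst (Z, A) \<union> snd (Z, A)} = card D - z - k" .
  qed
  have Y: "(\<Sum>p\<in>D. card (?Y p)) = Suc k * card (cuts v D z (Suc k))"
  proof (rule sum_card_cuts_containing[OF fin])
    fix Z A assume "(Z, A) \<in> cuts v D z (Suc k)"
    then have *: "A \<subseteq> D" "card A = Suc k" by (auto simp: cuts_def)
    then have "{p \<in> D. p \<in> snd (Z, A)} = A" by auto
    then show "card {p \<in> D. p \<in> snd (Z, A)} = Suc k" using * by simp
  qed
  have W: "(\<Sum>p\<in>D. card (?W p)) = Suc z * card (cuts v D (Suc z) k)"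
  proof (rule sum_card_cuts_containing[OF fin])
    fix Z A assume "(Z, A) \<in> cuts v D (Suc z) k"
    then have *: "Z \<subseteq> D" "card Z = Suc z" by (auto simp: cuts_def)
    then have "{p \<in> D. p \<in> fst (Z, A)} = Z" by auto
    then show "card {p \<in> D. p \<in> fst (Z, A)} = Suc z" using * by simp
  qed
  have "card (?X p) + card (?Y p) = card (cuts v (D - {p}) z k) + card (?W p)" if p: "p \<in> D" for p
  proof -
    let ?dom = "\<lambda>Z A. Z \<subseteq> D - {p} \<and> A \<subseteq> D - {p} - Z \<and> card Z = z \<and> card A = k"
    let ?Y' = "{(Z, A). ?dom Z A \<and> sign_cut v D Z (insert p A)}"
    let ?W' = "{(Z, A). ?dom Z A \<and> sign_cut v D (insert p Z) A}"
    have pert: "sign_cut v D Z A \<and> sign_cut v D Z (insert p A)"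
      if ZA: "?dom Z A" "sign_cut v D (insert p Z) A" for Z A
    proof -
      obtain e where "\<forall>i\<in>Z. e \<bullet> v i = 0" "0 < e \<bullet> v p"
        using interp[of Z p] ZA(1) p by blast
      then show ?thesis
        using sign_cut_perturb[OF fin p, of A Z e v] ZA by blast
    qed
    have "bij_betw (\<lambda>(Z, A). (Z, A - {p})) (?Y p) ?Y'"
    proof (rule bij_betw_byWitness[where f' = "\<lambda>(Z, A). (Z, insert p A)"])
      show "(\<lambda>(Z, A). (Z, A - {p})) ` (?Y p) \<subseteq> ?Y'"
        using p by (auto simp: cuts_def insert_absorb)
      show "(\<lambda>(Z, A). (Z, insert p A)) ` ?Y' \<subseteq> ?Y p"
      proof clarify
        fix Z A assume *: "Z \<subseteq> D - {p}" "A \<subseteq> D - {p} - Z" "sign_cut v D Z (insert p A)"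
          "z = card Z" "k = card A"
        have "finite A" "p \<notin> A" using * finsub[of A] by auto
        then show "(Z, insert p A) \<in> cuts v D (card Z) (Suc (card A)) \<and> p \<in> snd (Z, insert p A)"
          using * p by (auto simp: cuts_def)
      qed
    qed auto
    then have cY: "card (?Y p) = card ?Y'" by (rule bij_betw_same_card)
    have "bij_betw (\<lambda>(Z, A). (Z - {p}, A)) (?W p) ?W'"
    proof (rule bij_betw_byWitness[where f' = "\<lambda>(Z, A). (insert p Z, A)"])
      show "(\<lambda>(Z, A). (Z - {p}, A)) ` (?W p) \<subseteq> ?W'"
        using p by (auto simp: cuts_def insert_absorb)
      show "(\<lambda>(Z, A). (insert p Z, A)) ` ?W' \<subseteq> ?W p"
      proof clarify
        fix Z A assume *: "Z \<subseteq> D - {p}" "A \<subseteq> D - {p} - Z" "sign_cut v D (insert p Z) A"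
          "z = card Z" "k = card A"
        have "finite Z" "p \<notin> Z" using * finsub[of Z] by auto
        then show "(insert p Z, A) \<in> cuts v D (Suc (card Z)) (card A) \<and> p \<in> fst (insert p Z, A)"
          using * p by (auto simp: cuts_def)
      qed
    qed auto
    then have cW: "card (?W p) = card ?W'" by (rule bij_betw_same_card)
    have Xeq: "?X p = {(Z, A). ?dom Z A \<and> sign_cut v D Z A}"
      by (auto simp: cuts_def)
    \<comment> \<open>The sets \<open>?X p\<close> and \<open>?Y'\<close> are the extensions with \<open>p\<close> negative and positive; inclusion and
      exclusion for them is the local identity.\<close>
    have un: "?X p \<union> ?Y' = cuts v (D - {p}) z k"
    proof (intro equalityI subsetI)
      fix c assume "c \<in> ?X p \<union> ?Y'"
      then obtain Z A where c: "c = (Z, A)" "?dom Z A" "sign_cut v D Z A \<or> sign_cut v D Z (insert p A)"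
        unfolding Xeq by blast
      then have "p \<notin> Z" "p \<notin> A" by auto
      then have "sign_cut v (D - {p}) Z A" using c(3) sign_cut_restrict[of p Z A v D] by blast
      then show "c \<in> cuts v (D - {p}) z k" using c by (simp add: cuts_def)
    next
      fix c assume "c \<in> cuts v (D - {p}) z k"
      then obtain Z A where c: "c = (Z, A)" "?dom Z A" "sign_cut v (D - {p}) Z A"
        unfolding cuts_def by blast
      then have "sign_cut v D Z A \<or> sign_cut v D Z (insert p A)"
        using sign_cut_extend[OF p c(3)] pert by blast
      then show "c \<in> ?X p \<union> ?Y'" using c unfolding Xeq by blast
    qed
    have int: "?X p \<inter> ?Y' = ?W'"
    proof (intro equalityI subsetI)
      fix c assume "c \<in> ?X p \<inter> ?Y'"
      then obtain Z A where c: "c = (Z, A)" "?dom Z A" "sign_cut v D Z A" "sign_cut v D Z (insert p A)"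
        unfolding Xeq by blast
      then have "p \<notin> Z" "p \<notin> A" by auto
      then have "sign_cut v D (insert p Z) A" using c(3,4) p by (intro sign_cut_between)
      then show "c \<in> ?W'" using c by blast
    next
      fix c assume "c \<in> ?W'"
      then show "c \<in> ?X p \<inter> ?Y'" using pert unfolding Xeq by blast
    qed
    have "finite (?X p)" by (rule rev_finite_subset[OF finite_cuts[OF fin]]) auto
    moreover have "finite ?Y'"
      by (rule finite_subset[of _ "Pow D \<times> Pow D"]) (use fin in auto)
    ultimately show ?thesis
      using card_Un_Int[of "?X p" ?Y'] by (simp only: un int cY cW)
  qed
  then have "(\<Sum>p\<in>D. card (?X p) + card (?Y p)) =
      (\<Sum>p\<in>D. card (cuts v (D - {p}) z k) + card (?W p))"
    by (intro sum.cong) auto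
  then show ?thesis by (simp only: sum.distrib X Y W)
qed

section \<open>Solving the recursion\<close>

text \<open>
  The homogeneous equation \<open>(m - k) d k + (k + 1) d (k + 1) = 0\<close> is solved by alternating binomial
  coefficients. Dividing \<open>d\<close> by them, and likewise the right-hand side \<open>b\<close> by those for \<open>m - 1\<close>, turns
  the inhomogeneous equation into \<open>u k - u (k + 1) = (c / m) v k\<close>, which is solved by summation.
\<close>

lemma alternating_binomial_solution:
  fixes d b v :: "nat \<Rightarrow> real"
  assumes m: "0 < m"
    and rec: "\<And>k. k < m \<Longrightarrow> (real m - real k) * d k + (real k + 1) * d (Suc k) = c * b k"
    and b: "\<And>k. k < m \<Longrightarrow> b k = (-1) ^ k * real (m - 1 choose k) * v k"
    and "k \<le> m"
  shows "d k = (-1) ^ k * real (m choose k) * (d 0 - c / real m * (\<Sum>i<k. v i))"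
  using \<open>k \<le> m\<close>
proof (induction k)
  case 0
  then show ?case by simp
next
  case (Suc k)
  then have k: "k < m" and IH: "d k = (-1) ^ k * real (m choose k) * (d 0 - c / real m * (\<Sum>i<k. v i))"
    by auto
  define U where "U = d 0 - c / real m * (\<Sum>i<k. v i)"
  have mk: "real (m - k) = real m - real k" using k by (simp add: of_nat_diff)
  have nat1: "(m - k) * (m choose k) = m * (m - 1 choose k)"
    using binomial_absorb_comp[of m k] by simp
  have "(m - k) * (m choose k) = Suc k * (m choose Suc k)"
    using nat1 binomial_absorption[of k m] by simp
  then have c1: "(real m - real k) * real (m choose k) = (real k + 1) * real (m choose Suc k)"
    unfolding mk[symmetric] by (metis of_nat_Suc of_nat_mult add.commute)
  have c2: "(real m - real k) * real (m choose k) = real m * real (m - 1 choose k)"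
    unfolding mk[symmetric] by (metis nat1 of_nat_mult)
  have "(real k + 1) * d (Suc k) = c * b k - (real m - real k) * d k"
    using rec[OF k] by simp
  also have "\<dots> = (-1) ^ k * (c * (real (m - 1 choose k) * v k) - (real m - real k) * real (m choose k) * U)"
    unfolding b[OF k] IH[folded U_def] by (simp add: algebra_simps)
  also have "real (m - 1 choose k) = (real k + 1) * real (m choose Suc k) / real m"
    using c1 c2 m by (simp add: field_simps)
  also have "(-1) ^ k * (c * ((real k + 1) * real (m choose Suc k) / real m * v k) - (real m - real k) * real (m choose k) * U)
      = (real k + 1) * ((-1) ^ Suc k * real (m choose Suc k) * (U - c / real m * v k))"
    unfolding c1 by (simp add: algebra_simps)
  finally have "d (Suc k) = (-1) ^ Suc k * real (m choose Suc k) * (U - c / real m * v k)"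
    by (subst (asm) mult_cancel_left) auto
  then show ?case by (simp add: U_def algebra_simps)
qed

text \<open>
  Uniqueness of the solution of the deletion recursion, for the difference \<open>d\<close> of two solutions that
  agree after deletion of a dot. Put \<open>d z k = (-1) ^ k (n - z choose k) u\<^sub>z k\<close>. Then \<open>u\<^sub>3\<close> is constant in
  \<open>k\<close>, and each of \<open>u\<^sub>2\<close>, \<open>u\<^sub>1\<close>, \<open>u\<^sub>0\<close> is, up to a factor and a constant, the summation of the one before, so that \<open>u\<^sub>0\<close> is a cubic
  polynomial. The hypotheses on \<open>d 0\<close> and \<open>d 1\<close> are a discrete form of double zeros of \<open>u\<^sub>0\<close> at both
  ends of its range, and no cubic polynomial other than zero has these.
\<close>

lemma deletion_recursion_kernel:
  fixes d :: "nat \<Rightarrow> nat \<Rightarrow> real"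
  assumes n: "3 \<le> n"
    and rec: "\<And>z k. \<lbrakk>z \<le> 3; k + z < n\<rbrakk> \<Longrightarrow>
        (real n - real z - real k) * d z k + (real k + 1) * d z (Suc k) = (real z + 1) * d (Suc z) k"
    and d4: "\<And>k. d 4 k = 0"
    and bd: "d 0 0 = 0" "d 0 n = 0" "d 1 0 = 0" "d 1 (n - 1) = 0"
    and zk: "z \<le> 3" "k + z \<le> n"
  shows "d z k = 0"
proof -
  define N where "N = real n"
  have N: "N \<ge> 3" using n by (simp add: N_def)
  define h e where "h = d 3 0" and "e = d 2 0"
  define u2 where "u2 = (\<lambda>k. e - 3 / (N - 2) * (real k * h))"
  define u1 where "u1 = (\<lambda>k. 0 - 2 / (N - 1) * (\<Sum>i<k. u2 i))"
  have rN: "real (n - 1) = N - 1" "real (n - 2) = N - 2" "real (n - 3) = N - 3"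
    using n by (auto simp: N_def of_nat_diff)
  have R3: "d 3 k = (-1) ^ k * real (n - 3 choose k) * h" if "k \<le> n - 3" for k
  proof (cases "n = 3")
    case False
    show ?thesis
    proof (subst alternating_binomial_solution[where m = "n - 3" and c = 1 and b = "\<lambda>_. 0" and v = "\<lambda>_. 0" and d = "d 3"])
      fix k assume "k < n - 3"
      then show "(real (n - 3) - real k) * d 3 k + (real k + 1) * d 3 (Suc k) = 1 * 0"
        using rec[of 3 k] d4 rN by (simp add: N_def algebra_simps)
    qed (use that n False in \<open>auto simp: h_def\<close>)
  qed (use that in \<open>auto simp: h_def\<close>)
  have R2: "d 2 k = (-1) ^ k * real (n - 2 choose k) * u2 k" if "k \<le> n - 2" for k
  proof (subst alternating_binomial_solution[where m = "n - 2" and c = 3 and b = "d 3" and v = "\<lambda>_. h" and d = "d 2"])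
    fix k assume k: "k < n - 2"
    show "(real (n - 2) - real k) * d 2 k + (real k + 1) * d 2 (Suc k) = 3 * d 3 k"
      using rec[of 2 k] k rN by (simp add: N_def algebra_simps numeral_3_eq_3)
    show "d 3 k = (-1) ^ k * real (n - 2 - 1 choose k) * h"
      using R3[of k] k by (simp add: numeral_3_eq_3)
  qed (use that n in \<open>auto simp: u2_def e_def rN\<close>)
  have R1: "d 1 k = (-1) ^ k * real (n - 1 choose k) * u1 k" if "k \<le> n - 1" for k
  proof (subst alternating_binomial_solution[where m = "n - 1" and c = 2 and b = "d 2" and v = u2 and d = "d 1"])
    fix k assume k: "k < n - 1"
    show "(real (n - 1) - real k) * d 1 k + (real k + 1) * d 1 (Suc k) = 2 * d 2 k"
      using rec[of 1 k] k rN by (simp add: N_def algebra_simps numeral_2_eq_2)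
    show "d 2 k = (-1) ^ k * real (n - 1 - 1 choose k) * u2 k"
      using R2[of k] k by (simp add: numeral_2_eq_2)
  qed (use that n bd in \<open>auto simp: u1_def rN N_def\<close>)
  have R0: "d 0 k = (-1) ^ k * real (n choose k) * (0 - 1 / N * (\<Sum>i<k. u1 i))" if "k \<le> n" for k
  proof (subst alternating_binomial_solution[where m = n and c = 1 and b = "d 1" and v = u1 and d = "d 0"])
    fix k assume k: "k < n"
    show "(real n - real k) * d 0 k + (real k + 1) * d 0 (Suc k) = 1 * d 1 k"
      using rec[of 0 k] k rN by (simp add: N_def algebra_simps)
    show "d 1 k = (-1) ^ k * real (n - 1 choose k) * u1 k"
      using R1[of k] k by simp
  qed (use that n bd in \<open>auto simp: N_def\<close>)
  have S2: "(\<Sum>i<k. u2 i) = real k * e - 3 / (N - 2) * h * (real k * (real k - 1) / 2)" for k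
  proof (induction k)
    case (Suc k)
    have "N - 2 \<noteq> 0" using N by auto
    then show ?case
      unfolding sum.lessThan_Suc Suc by (simp add: u2_def divide_simps) (simp add: algebra_simps)
  qed simp
  have S1: "(\<Sum>i<k. u1 i) = - 2 / (N - 1) *
      (e * (real k * (real k - 1) / 2) - 3 / (N - 2) * h * (real k * (real k - 1) * (real k - 2) / 6))" for k
  proof (induction k)
    case (Suc k)
    have "N - 1 \<noteq> 0" "N - 2 \<noteq> 0" using N by auto
    then show ?case
      unfolding sum.lessThan_Suc Suc by (simp add: u1_def S2 divide_simps) (simp add: algebra_simps)
  qed simp
  \<comment> \<open>Only the constants \<open>h\<close> and \<open>e\<close> are left. The vanishing of \<open>u1\<close> and of the sum of \<open>u1\<close> at the upper end
    gives two independent linear equations for them.\<close>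
  have N0: "- 2 / (N - 1) \<noteq> 0" using N by simp
  have a: "u1 (n - 1) = 0" using R1[of "n - 1"] bd by auto
  have b: "u1 (n - 1) = - 2 / (N - 1) * ((N - 1) * e - 3 / (N - 2) * h * ((N - 1) * (N - 1 - 1) / 2))"
    unfolding u1_def S2 rN by simp
  have c: "3 / (N - 2) * h * ((N - 1) * (N - 1 - 1) / 2) = 3 / 2 * h * (N - 1)"
    using N by (simp add: divide_simps)
  have "(N - 1) * e - 3 / 2 * h * (N - 1) = 0"
    using a N0 unfolding b c mult_eq_0_iff by blast
  then have "(N - 1) * (e - 3 / 2 * h) = 0"
    by (simp add: algebra_simps)
  then have E1: "e = 3 / 2 * h" using N by simp
  have a: "(\<Sum>i<n. u1 i) = 0" using R0[of n] bd N by auto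
  have c: "3 / (N - 2) * h * (N * (N - 1) * (N - 2) / 6) = h * (N * (N - 1) / 2)"
    using N by (simp add: divide_simps)
  have "e * (N * (N - 1) / 2) - h * (N * (N - 1) / 2) = 0"
    using a N0 unfolding S1 N_def[symmetric] c mult_eq_0_iff by blast
  then have "N * (N - 1) * (e - h) = 0"
    by (simp add: field_simps)
  then have "e = h" using N by simp
  then have h0: "h = 0" "e = 0" using E1 by auto
  have u: "u2 = (\<lambda>_. 0)" "u1 = (\<lambda>_. 0)" by (auto simp: u1_def u2_def h0)
  consider "z = 0" | "z = 1" | "z = 2" | "z = 3" using zk(1) by linarith
  then show ?thesis
    by cases (use R0[of k] R1[of k] R2[of k] R3[of k] zk(2) in \<open>auto simp: u h0\<close>)
qed

text \<open>
  The closed forms for the number of patterns with \<open>z\<close> zeros and \<open>k\<close> plus signs. For \<open>z = 3\<close> this is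
  the number of circles through three dots with one side chosen that contains \<open>k\<close> dots. The rows
  \<open>z = 0\<close> and \<open>z = 1\<close> have exceptional values at the ends of the range of \<open>k\<close>, where all remaining dots lie
  on one side.
\<close>

definition expected_cuts :: "nat \<Rightarrow> nat \<Rightarrow> nat \<Rightarrow> real" where
  "expected_cuts n z k =
    (if z = 0 then (if k = 0 \<or> k = n then 1 else 2 * real k * (real n - real k) - real n + 2)
     else if z = 1 then (if k = 0 \<or> k = n - 1 then real n else 6 * real k * (real n - 1 - real k))
     else if z = 2 then
       3 * ((real k + 1) * (real n - 2 - real k) + real k * (real n - 1 - real k))
     else if z = 3 then 2 * (real k + 1) * (real n - 2 - real k)
     else 0)"

lemma expected_cuts_recursion:
  assumes n: "5 \<le> n" and z: "z \<le> 3" and kz: "k + z < n"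
  shows "(real n - real z - real k) * expected_cuts n z k + (real k + 1) * expected_cuts n z (Suc k) =
     real n * expected_cuts (n - 1) z k + (real z + 1) * expected_cuts n (Suc z) k"
proof -
  obtain m where m: "n = Suc (Suc m)" "3 \<le> m"
    using n by (intro that[of "n - 2"]) auto
  consider "z = 0" | "z = 1" | "z = 2" | "z = 3"
    using z by linarith
  then show ?thesis
  proof cases
    case 1
    show ?thesis
      by (cases "k = 0"; cases "k = Suc m") (use kz in \<open>simp_all add: 1 m(1) expected_cuts_def algebra_simps\<close>)
  next
    case 2
    show ?thesis
      by (cases "k = 0"; cases "k = m") (use m(2) in \<open>simp_all add: 2 m(1) expected_cuts_def algebra_simps\<close>)
  next
    case 3
    show ?thesis by (simp add: 3 m(1) expected_cuts_def algebra_simps)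
  next
    case 4
    show ?thesis by (simp add: 4 m(1) expected_cuts_def algebra_simps)
  qed
qed

section \<open>Counting sign patterns of convex configurations in four dimensions\<close>

text \<open>
  General position in \<open>\<real>\<^sup>4\<close>: a functional that vanishes at four dots is zero, so that any four of the
  vectors form a basis.
\<close>

definition spanning_quadruples :: "('i \<Rightarrow> 'e::real_inner) \<Rightarrow> 'i set \<Rightarrow> bool" where
  "spanning_quadruples v D \<longleftrightarrow>
     (\<forall>S u. S \<subseteq> D \<longrightarrow> card S = 4 \<longrightarrow> (\<forall>i\<in>S. u \<bullet> v i = 0) \<longrightarrow> u = 0)"

text \<open>
  The vectors lie in an open half space, and each of them spans an extreme ray of the cone that they
  generate. For dots on a sphere, the second condition is witnessed by the tangent planes.
\<close>

definition convex_configuration :: "('i \<Rightarrow> 'e::real_inner) \<Rightarrow> 'i set \<Rightarrow> bool" where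
  "convex_configuration v D \<longleftrightarrow>
     (\<exists>u. \<forall>i\<in>D. 0 < u \<bullet> v i) \<and> (\<forall>p\<in>D. \<exists>u. u \<bullet> v p = 0 \<and> (\<forall>i\<in>D - {p}. u \<bullet> v i < 0))"

lemma spanning_quadruples_mono:
  assumes "spanning_quadruples v D" and "D' \<subseteq> D"
  shows "spanning_quadruples v D'"
  unfolding spanning_quadruples_def
proof (intro allI impI)
  fix S u assume "S \<subseteq> D'" "card S = 4" "\<forall>i\<in>S. u \<bullet> v i = 0"
  moreover from this have "S \<subseteq> D" using assms(2) by simp
  ultimately show "u = 0" using assms(1) by (simp add: spanning_quadruples_def)
qed

lemma convex_configuration_mono:
  assumes "convex_configuration v D" and "D' \<subseteq> D"
  shows "convex_configuration v D'"
  unfolding convex_configuration_def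
proof (intro conjI ballI)
  obtain u where "\<forall>i\<in>D. 0 < u \<bullet> v i"
    using assms(1) by (auto simp: convex_configuration_def)
  then show "\<exists>u. \<forall>i\<in>D'. 0 < u \<bullet> v i"
    using assms(2) by (intro exI[of _ u]) auto
next
  fix p assume "p \<in> D'"
  then have "p \<in> D" using assms(2) by auto
  then obtain u where "u \<bullet> v p = 0" "\<forall>i\<in>D - {p}. u \<bullet> v i < 0"
    using assms(1) by (auto simp: convex_configuration_def)
  then show "\<exists>u. u \<bullet> v p = 0 \<and> (\<forall>i\<in>D' - {p}. u \<bullet> v i < 0)"
    using assms(2) by (intro exI[of _ u]) auto
qed

text \<open>
  In general position, the values of a functional at up to four dots can be prescribed. This supplies
  the functionals needed to push a circle off one of its dots.
\<close>

lemma interpolate: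
  fixes v :: "'i \<Rightarrow> 'e::euclidean_space" and g :: "'i \<Rightarrow> real"
  assumes dim: "DIM('e) = 4" and fin: "finite D" and gp: "spanning_quadruples v D"
    and D: "4 \<le> card D" and Z: "Z \<subseteq> D" "card Z \<le> 4"
  shows "\<exists>u. \<forall>i\<in>Z. u \<bullet> v i = g i"
proof -
  obtain S where S: "Z \<subseteq> S" "S \<subseteq> D" "card S = 4"
    using exists_subset_between[of Z 4 D] D Z fin by auto
  have finS: "finite S" using S(3) by (metis card.infinite zero_neq_numeral)
  have span: "span (v ` S) = UNIV"
  proof (rule ccontr)
    assume "span (v ` S) \<noteq> UNIV"
    then obtain u where "u \<noteq> 0" "\<forall>x\<in>span (v ` S). u \<bullet> x = 0"
      using span_not_UNIV_orthogonal by blast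
    then show False
      using gp S(2,3) unfolding spanning_quadruples_def by (metis imageI span_base)
  qed
  have le: "card (v ` S) \<le> 4" using card_image_le[OF finS, of v] S(3) by simp
  have "dim (UNIV :: 'e set) \<le> card (v ` S)"
    by (rule span_card_ge_dim) (use span finS in auto)
  then have inj: "inj_on v S"
    using le S(3) dim finS by (intro eq_card_imp_inj_on) auto
  have ind: "independent (v ` S)"
    by (rule card_le_dim_spanning[of _ UNIV]) (use span finS le dim in auto)
  obtain f where f: "linear f" "\<forall>x\<in>v ` S. f x = g (inv_into S v x)"
    using linear_independent_extend[OF ind, of "\<lambda>x. g (inv_into S v x)"] by blast
  show ?thesis
  proof (intro exI[of _ "adjoint f 1"] ballI)
    fix i assume "i \<in> Z"
    then have i: "i \<in> S" using S(1) by blast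
    have "adjoint f 1 \<bullet> v i = f (v i)"
      using adjoint_works[OF f(1), of "v i" 1] by (simp add: inner_commute)
    then show "adjoint f 1 \<bullet> v i = g i"
      using f(2) i inv_into_f_f[OF inj i] by simp
  qed
qed

text \<open>
  The base of the induction. It has to be four: three dots have a single pattern with three zeros,
  where the closed form gives two, because a functional that vanishes at all dots has no signs left
  that would distinguish it from its negative.
\<close>

lemma card_cuts_of_four:
  fixes v :: "'i \<Rightarrow> 'e::euclidean_space"
  assumes dim: "DIM('e) = 4" and fin: "finite D" and gp: "spanning_quadruples v D"
    and D: "card D = 4" and zk: "z \<le> 3" "k + z \<le> 4"
  shows "real (card (cuts v D z k)) = expected_cuts 4 z k"
proof -
  have all: "sign_cut v D Z A" if "Z \<subseteq> D" "A \<subseteq> D - Z" for Z A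
  proof -
    obtain u where u: "\<forall>i\<in>D. u \<bullet> v i = (if i \<in> Z then 0 else if i \<in> A then 1 else - 1)"
      using interpolate[OF dim fin gp, of D "\<lambda>i. if i \<in> Z then 0 else if i \<in> A then 1 else - 1"] D
      by auto
    show ?thesis
      unfolding sign_cut_def by (rule exI[of _ u]) (use u that in auto)
  qed
  have "cuts v D z k = Sigma {Z. Z \<subseteq> D \<and> card Z = z} (\<lambda>Z. {A. A \<subseteq> D - Z \<and> card A = k})"
    using all by (auto simp: cuts_def)
  also have "card \<dots> = (\<Sum>Z\<in>{Z. Z \<subseteq> D \<and> card Z = z}. 4 - z choose k)"
  proof (subst card_SigmaI)
    show "\<forall>Z\<in>{Z. Z \<subseteq> D \<and> card Z = z}. finite {A. A \<subseteq> D - Z \<and> card A = k}"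
      using fin by auto
    show "(\<Sum>Z\<in>{Z. Z \<subseteq> D \<and> card Z = z}. card {A. A \<subseteq> D - Z \<and> card A = k}) =
        (\<Sum>Z\<in>{Z. Z \<subseteq> D \<and> card Z = z}. 4 - z choose k)"
    proof (rule sum.cong)
      fix Z assume "Z \<in> {Z. Z \<subseteq> D \<and> card Z = z}"
      then show "card {A. A \<subseteq> D - Z \<and> card A = k} = (4 - z choose k)"
        using fin D card_Diff_subset[of Z D] finite_subset[of Z D] n_subsets[of "D - Z" k] by auto
    qed simp
  qed (use fin in auto)
  also have "\<dots> = (4 choose z) * (4 - z choose k)"
    using n_subsets[OF fin, of z] D by simp
  finally have c: "card (cuts v D z k) = (4 choose z) * (4 - z choose k)" .
  have "z = 0 \<or> z = 1 \<or> z = 2 \<or> z = 3" "k = 0 \<or> k = 1 \<or> k = 2 \<or> k = 3 \<or> k = 4"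
    using zk by linarith+
  then show ?thesis
    unfolding c using zk by (elim disjE) (simp_all add: expected_cuts_def eval_nat_numeral)
qed

lemma cuts_four_zeros_empty:
  assumes "finite D" "spanning_quadruples v D" "5 \<le> card D"
  shows "cuts v D 4 k = {}"
proof -
  have False if "(Z, A) \<in> cuts v D 4 k" for Z A
  proof -
    have Z: "Z \<subseteq> D" "card Z = 4" and "sign_cut v D Z A" using that by (auto simp: cuts_def)
    then obtain u where u: "\<forall>i\<in>Z. u \<bullet> v i = 0" "\<forall>i\<in>A. 0 < u \<bullet> v i" "\<forall>i\<in>D - Z - A. u \<bullet> v i < 0"
      by (auto simp: sign_cut_def)
    have "u = 0" using assms(2) Z u(1) unfolding spanning_quadruples_def by blast
    then have "A = {}" "D - Z - A = {}" using u by auto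
    then have "D = Z" using Z by blast
    then show False using Z assms(3) by simp
  qed
  then show ?thesis by auto
qed

lemma sign_cut_uminus:
  assumes "sign_cut v D Z A" "A \<subseteq> D - Z"
  shows "sign_cut v D Z (D - Z - A)"
proof -
  obtain u where u: "\<forall>i\<in>Z. u \<bullet> v i = 0" "\<forall>i\<in>A. 0 < u \<bullet> v i" "\<forall>i\<in>D - Z - A. u \<bullet> v i < 0"
    using assms(1) by (auto simp: sign_cut_def)
  show ?thesis
    unfolding sign_cut_def by (rule exI[of _ "- u"]) (use u in auto)
qed

text \<open>
  The boundary values that single out the solution of the recursion. This is where convexity enters:
  the patterns with one zero and all other signs equal are realised at every dot.
\<close>

lemma card_cuts_boundary:
  assumes fin: "finite D" and conv: "convex_configuration v D"
  shows "card (cuts v D 0 0) = 1" "card (cuts v D 0 (card D)) = 1"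
    and "card (cuts v D 1 0) = card D" "card (cuts v D 1 (card D - 1)) = card D"
proof -
  have finsub: "finite S" if "S \<subseteq> D" for S using fin that by (rule rev_finite_subset)
  have all: "sign_cut v D {} D"
    using conv by (auto simp: sign_cut_def convex_configuration_def)
  have none: "sign_cut v D {} {}"
    using sign_cut_uminus[OF all] by simp
  have tan: "sign_cut v D {p} {}" if p: "p \<in> D" for p
  proof -
    obtain u where "u \<bullet> v p = 0" "\<forall>i\<in>D - {p}. u \<bullet> v i < 0"
      using conv p unfolding convex_configuration_def by blast
    then show ?thesis
      unfolding sign_cut_def by (intro exI[of _ u]) auto
  qed
  have tan': "sign_cut v D {p} (D - {p})" if p: "p \<in> D" for p
    using sign_cut_uminus[OF tan[OF p]] by simp
  have "cuts v D 0 0 = {({}, {})}"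
    using none finsub by (auto simp: cuts_def)
  then show "card (cuts v D 0 0) = 1" by simp
  have "A = D" if "A \<subseteq> D" "card A = card D" for A
    using card_subset_eq[OF fin] that by blast
  then have "cuts v D 0 (card D) = {({}, D)}"
    using all finsub by (auto simp: cuts_def)
  then show "card (cuts v D 0 (card D)) = 1" by simp
  have "A = {}" if "A \<subseteq> D - {p}" "card A = 0" for A p
    using that finsub[of A] card_0_eq[of A] by blast
  then have "cuts v D 1 0 = (\<lambda>p. ({p}, {})) ` D"
    using tan by (auto simp: cuts_def card_1_singleton_iff)
  then show "card (cuts v D 1 0) = card D"
    by (simp add: card_image inj_on_def)
  have full: "A = D - {p}" if "A \<subseteq> D - {p}" "card A = card D - 1" "p \<in> D" for A p
    using card_subset_eq[of "D - {p}" A] that fin by simp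
  have "cuts v D 1 (card D - 1) = (\<lambda>p. ({p}, D - {p})) ` D"
  proof (intro equalityI subsetI)
    fix c assume "c \<in> cuts v D 1 (card D - 1)"
    then obtain p A where c: "c = ({p}, A)" "p \<in> D" "A \<subseteq> D - {p}" "card A = card D - 1"
      by (auto simp: cuts_def card_1_singleton_iff)
    then have "A = D - {p}" by (intro full)
    then show "c \<in> (\<lambda>p. ({p}, D - {p})) ` D" using c by blast
  qed (use tan' fin in \<open>auto simp: cuts_def\<close>)
  then show "card (cuts v D 1 (card D - 1)) = card D"
    by (simp add: card_image inj_on_def)
qed

text \<open>
  The closed forms satisfy the same recursion and the same boundary conditions as the true numbers, so
  the difference \<open>d\<close> of both falls under the uniqueness lemma \<open>deletion_recursion_kernel\<close>.
\<close>

theorem card_cuts: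
  fixes v :: "'i \<Rightarrow> 'e::euclidean_space"
  assumes dim: "DIM('e) = 4" and n: "4 \<le> n"
  shows "\<lbrakk>finite D; card D = n; spanning_quadruples v D; convex_configuration v D; z \<le> 3; k + z \<le> n\<rbrakk>
    \<Longrightarrow> real (card (cuts v D z k)) = expected_cuts n z k"
  using n
proof (induction n arbitrary: D z k rule: nat_induct_at_least)
  case base
  show ?case by (rule card_cuts_of_four[OF dim base.prems(1,3,2,5,6)])
next
  case (Suc m)
  note fin = \<open>finite D\<close> and cD = \<open>card D = Suc m\<close> and gp = \<open>spanning_quadruples v D\<close>
    and conv = \<open>convex_configuration v D\<close>
  define n where "n = Suc m"
  have n5: "5 \<le> n" and cDn: "card D = n" using Suc.hyps cD by (auto simp: n_def)
  define d where "d = (\<lambda>z k. real (card (cuts v D z k)) - expected_cuts n z k)"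
  have rec: "(real n - real z - real k) * d z k + (real k + 1) * d z (Suc k) = (real z + 1) * d (Suc z) k"
    if z: "z \<le> 3" and kz: "k + z < n" for z k
  proof -
    have "\<exists>e. (\<forall>i\<in>Z. e \<bullet> v i = 0) \<and> 0 < e \<bullet> v p"
      if Z: "Z \<subseteq> D" "card Z = z" "p \<in> D - Z" for Z p
    proof -
      have "finite Z" using fin Z(1) by (rule rev_finite_subset)
      then have "card (insert p Z) \<le> 4" "insert p Z \<subseteq> D"
        using Z z by simp_all
      moreover have "4 \<le> card D" using n5 cDn by simp
      ultimately obtain e where e: "\<forall>i\<in>insert p Z. e \<bullet> v i = (if i = p then 1 else 0)"
        using interpolate[OF dim fin gp, of "insert p Z" "\<lambda>i. if i = p then 1 else 0"] by blast
      then have "e \<bullet> v i = 0" if "i \<in> Z" for i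
        using that Z(3) by auto
      moreover have "e \<bullet> v p = 1" using e by simp
      ultimately show ?thesis by (intro exI[of _ e]) simp
    qed
    then have eq: "(card D - z - k) * card (cuts v D z k) + Suc k * card (cuts v D z (Suc k)) =
        (\<Sum>p\<in>D. card (cuts v (D - {p}) z k)) + Suc z * card (cuts v D (Suc z) k)"
      by (intro cuts_deletion[OF fin])
    have "real (card (cuts v (D - {p}) z k)) = expected_cuts m z k" if "p \<in> D" for p
      using Suc.IH[of "D - {p}" z k] that fin cD z kz gp conv spanning_quadruples_mono[of v D "D - {p}"]
        convex_configuration_mono[of v D "D - {p}"] by (auto simp: n_def)
    then have del: "(\<Sum>p\<in>D. real (card (cuts v (D - {p}) z k))) = real n * expected_cuts m z k"
      using cDn by simp
    have diff: "real (card D - z - k) = real n - real z - real k"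
      using kz cDn by (simp add: of_nat_diff)
    then have "(real n - real z - real k) * real (card (cuts v D z k)) + (real k + 1) * real (card (cuts v D z (Suc k))) =
        real n * expected_cuts m z k + (real z + 1) * real (card (cuts v D (Suc z) k))"
      using arg_cong[OF eq, of real]
      unfolding of_nat_add of_nat_mult of_nat_sum del diff of_nat_Suc by (simp add: add.commute)
    then show ?thesis
      using expected_cuts_recursion[OF n5 z kz] by (simp add: d_def n_def algebra_simps)
  qed
  have "d z k = 0"
  proof (rule deletion_recursion_kernel[OF _ rec])
    show "3 \<le> n" using n5 by simp
    show "d 4 k = 0" for k
      using cuts_four_zeros_empty[OF fin gp] n5 cDn by (simp add: d_def expected_cuts_def)
    show "d 0 0 = 0" "d 0 n = 0" "d 1 0 = 0" "d 1 (n - 1) = 0"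
      using card_cuts_boundary[OF fin conv] cDn by (simp_all add: d_def expected_cuts_def)
    show "z \<le> 3" "k + z \<le> n" using Suc.prems by (auto simp: n_def)
  qed
  then show ?case by (simp add: d_def n_def)
qed

text \<open>
  Three dots are treated directly: every subset of size one is cut off by a slight shift of a tangent
  plane, and the subsets of size two are the complements.
\<close>

theorem card_separable_subsets:
  fixes v :: "'i \<Rightarrow> 'e::euclidean_space"
  assumes dim: "DIM('e) = 4" and fin: "finite D" and n: "3 \<le> card D"
    and gp: "spanning_quadruples v D" and conv: "convex_configuration v D"
    and k: "1 \<le> k" "k < card D"
  shows "int (card {A. A \<subseteq> D \<and> card A = k \<and> sign_cut v D {} A}) =
     2 * int k * (int (card D) - int k) - int (card D) + 2"
proof (cases "card D = 3")
  case False
  have eq: "cuts v D 0 k = Pair {} ` {A. A \<subseteq> D \<and> card A = k \<and> sign_cut v D {} A}"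
  proof -
    have "Z = {}" if "Z \<subseteq> D" "card Z = 0" for Z
      using that rev_finite_subset[OF fin] by auto
    then show ?thesis by (auto simp: cuts_def)
  qed
  have "real (card (cuts v D 0 k)) = expected_cuts (card D) 0 k"
    using card_cuts[OF dim, of "card D" D v 0 k] n False fin gp conv k by auto
  then have "real (card {A. A \<subseteq> D \<and> card A = k \<and> sign_cut v D {} A}) =
      2 * real k * (real (card D) - real k) - real (card D) + 2"
    using k by (simp add: eq card_image inj_on_def expected_cuts_def)
  then have "real_of_int (int (card {A. A \<subseteq> D \<and> card A = k \<and> sign_cut v D {} A})) =
      real_of_int (2 * int k * (int (card D) - int k) - int (card D) + 2)"
    by simp
  then show ?thesis by (subst (asm) of_int_eq_iff)
next
  case True
  have single: "sign_cut v D {} {p}" if p: "p \<in> D" for p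
  proof -
    obtain e where e: "\<forall>i\<in>D. 0 < e \<bullet> v i"
      using conv by (auto simp: convex_configuration_def)
    obtain u where "u \<bullet> v p = 0" "\<forall>i\<in>D - {p}. u \<bullet> v i < 0"
      using conv p unfolding convex_configuration_def by blast
    then have "sign_cut v D {p} {}"
      unfolding sign_cut_def by (intro exI[of _ u]) auto
    then show ?thesis
      using sign_cut_perturb(2)[OF fin p, of "{}" "{}" e v] e p by auto
  qed
  have "sign_cut v D {} A" if A: "A \<subseteq> D" "card A = k" for A
  proof (cases "k = 1")
    case True
    then show ?thesis using A single by (auto simp: card_1_singleton_iff)
  next
    case False
    then have "card (D - A) = 1"
      using A k True fin by (simp add: card_Diff_subset finite_subset)
    then obtain p where p: "D - A = {p}" by (auto simp: card_1_singleton_iff)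
    then have "A = D - {} - {p}" "p \<in> D" using A by auto
    then show ?thesis using sign_cut_uminus[of v D "{}" "{p}"] single[of p] by auto
  qed
  then have "{A. A \<subseteq> D \<and> card A = k \<and> sign_cut v D {} A} = {A. A \<subseteq> D \<and> card A = k}"
    by blast
  then have "card {A. A \<subseteq> D \<and> card A = k \<and> sign_cut v D {} A} = (3 choose k)"
    using n_subsets[OF fin, of k] True by simp
  moreover have "k = 1 \<or> k = 2" using k True by linarith
  ultimately show ?thesis
    using True by (auto simp: eval_nat_numeral)
qed

text \<open>
  From subsets to unordered partitions: for \<open>k = l\<close> both parts of a partition are counted among the
  subsets of size \<open>k\<close>, otherwise only one.
\<close>

lemma card_complementary_pairs:
  fixes D :: "'i set"
  assumes fin: "finite D" and kl: "card D = k + l" "1 \<le> k"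
    and SD: "\<And>A. A \<in> S \<Longrightarrow> A \<subseteq> D" and compl: "\<And>A. A \<in> S \<Longrightarrow> D - A \<in> S"
  shows "card ((\<lambda>A. {A, D - A}) ` {A \<in> S. card A = k}) * (if k = l then 2 else 1) =
     card {A \<in> S. card A = k}"
proof (cases "k = l")
  case False
  have "inj_on (\<lambda>A. {A, D - A}) {A \<in> S. card A = k}"
  proof (rule inj_onI)
    fix A B assume AB: "A \<in> {A \<in> S. card A = k}" "B \<in> {A \<in> S. card A = k}" "{A, D - A} = {B, D - B}"
    have "card (D - B) = l"
      using AB SD[of B] kl fin card_Diff_subset[of B D] finite_subset[of B D] by auto
    then have "A \<noteq> D - B" using AB False by auto
    then show "A = B" using AB(3) by (metis doubleton_eq_iff)
  qed
  then show ?thesis using False by (simp add: card_image)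
next
  case True
  let ?P = "(\<lambda>A. {A, D - A}) ` {A \<in> S. card A = k}"
  have cc: "card (D - A) = k" "D - A \<noteq> A" "D - (D - A) = A" if "A \<in> S" "card A = k" for A
  proof -
    show "card (D - A) = k"
      using that SD[OF that(1)] kl fin True by (simp add: card_Diff_subset finite_subset)
    have "A \<noteq> {}" using that kl by auto
    then show "D - A \<noteq> A" by blast
    show "D - (D - A) = A" using SD[OF that(1)] by blast
  qed
  have U: "\<Union>?P = {A \<in> S. card A = k}"
    using cc compl by auto
  have finS: "finite {A \<in> S. card A = k}"
    by (rule finite_subset[of _ "Pow D"]) (use SD fin in auto)
  have "2 * card ?P = card (\<Union>?P)"
  proof (rule card_partition)
    show "card c = 2" if c: "c \<in> ?P" for c
    proof -
      obtain A where A: "A \<in> S" "card A = k" "c = {A, D - A}" using c by blast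
      then show ?thesis using cc(2)[OF A(1,2)] by (auto simp: card_insert_if)
    qed
    fix c c' assume *: "c \<in> ?P" "c' \<in> ?P" "c \<noteq> c'"
    obtain A B where AB: "A \<in> S" "card A = k" "c = {A, D - A}" "B \<in> S" "card B = k" "c' = {B, D - B}"
      using * by blast
    have "A \<noteq> B" "A \<noteq> D - B" "D - A \<noteq> B" "D - A \<noteq> D - B"
      using *(3) AB cc(3)[of A] cc(3)[of B] by auto
    then show "c \<inter> c' = {}" using AB by auto
  qed (use U finS in auto)
  then show ?thesis using True U by simp
qed

text \<open>
  The common conclusion for plane and sphere. What remains to be provided in either case is a lift of
  the dots to \<open>\<real>\<^sup>4\<close> under which separation by circles becomes separation by functionals.
\<close>

theorem card_separable_partitions:
  fixes v :: "'i::topological_space \<Rightarrow> 'e::euclidean_space"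
  assumes dim: "DIM('e) = 4" and fin: "finite D" and n: "3 \<le> card D"
    and gp: "spanning_quadruples v D" and conv: "convex_configuration v D"
    and kl: "1 \<le> k" "1 \<le> l" "card D = k + l"
    and sep: "\<And>A. \<lbrakk>A \<subseteq> D; A \<noteq> {}; A \<noteq> D\<rbrakk> \<Longrightarrow>
        separated_by_circle X \<C> D A (D - A) \<longleftrightarrow> sign_cut v D {} A"
  shows "int (card (separable_partitions X \<C> D k l)) =
     (if k \<noteq> l then 2 * int k * int l - int k - int l + 2 else (int k)\<^sup>2 - int k + 1)"
proof -
  define S where "S = {A. A \<subseteq> D \<and> sign_cut v D {} A}"
  have card_l: "card (D - A) = l" if "A \<subseteq> D" "card A = k" for A
    using that kl fin by (simp add: card_Diff_subset finite_subset)
  have "separable_partitions X \<C> D k l = (\<lambda>A. {A, D - A}) ` {A \<in> S. card A = k}" (is "?L = ?R")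
  proof (intro equalityI subsetI)
    fix P assume "P \<in> ?L"
    then obtain A B where P: "P = {A, B}" "A \<noteq> B" "partition_on D {A, B}" "card A = k"
        "separated_by_circle X \<C> D A B"
      unfolding separable_partitions_def by blast
    have "A \<union> B = D" "A \<inter> B = {}"
      using P(2,3) by (auto simp: partition_on_def disjoint_def)
    then have B: "B = D - A" "A \<subseteq> D" by auto
    have "A \<noteq> {}" "A \<noteq> D" using P(3) B by (auto simp: partition_on_def)
    then have "sign_cut v D {} A" using sep[OF B(2)] P(5) B(1) by simp
    then have "A \<in> {A \<in> S. card A = k}" using P(4) B(2) by (simp add: S_def)
    then show "P \<in> ?R" using P(1) B by blast
  next
    fix P assume "P \<in> ?R"
    then obtain A where A: "P = {A, D - A}" "A \<subseteq> D" "sign_cut v D {} A" "card A = k"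
      by (auto simp: S_def)
    have ne: "A \<noteq> {}" using A(4) kl(1) by auto
    have "card (D - A) \<noteq> 0" using card_l[OF A(2,4)] kl(2) by simp
    then have ne': "D - A \<noteq> {}" by (metis card.empty)
    then have "A \<noteq> D" by auto
    then have "separated_by_circle X \<C> D A (D - A)" using sep[OF A(2) ne] A(3) by simp
    moreover have "partition_on D {A, D - A}"
      using A(2) ne ne' by (auto simp: partition_on_def disjoint_def)
    moreover have "A \<noteq> D - A" using ne by blast
    ultimately show "P \<in> ?L"
      unfolding separable_partitions_def mem_Collect_eq
      using A(1,4) card_l[OF A(2,4)] by (intro exI[of _ A] exI[of _ "D - A"] conjI)
  qed
  moreover have "card ((\<lambda>A. {A, D - A}) ` {A \<in> S. card A = k}) * (if k = l then 2 else 1) =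
      card {A \<in> S. card A = k}"
    by (rule card_complementary_pairs)
      (use fin kl sign_cut_uminus[of v D "{}"] in \<open>auto simp: S_def\<close>)
  moreover have "{A \<in> S. card A = k} = {A. A \<subseteq> D \<and> card A = k \<and> sign_cut v D {} A}"
    by (auto simp: S_def)
  ultimately have "int (card (separable_partitions X \<C> D k l)) * (if k = l then 2 else 1) =
      2 * int k * (int (card D) - int k) - int (card D) + 2"
    using card_separable_subsets[OF dim fin n gp conv kl(1)] kl
    by (auto simp flip: of_nat_mult)
  then show ?thesis
    using kl by (auto simp: algebra_simps power2_eq_square split: if_splits)
qed

section \<open>The two sides of a circle\<close>

lemma connected_nonzero_sign:
  fixes f :: "'a::topological_space \<Rightarrow> real"
  assumes K: "connected K" and f: "continuous_on K f" and nz: "\<And>x. x \<in> K \<Longrightarrow> f x \<noteq> 0"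
  shows "(\<forall>x\<in>K. 0 < f x) \<or> (\<forall>x\<in>K. f x < 0)"
proof (rule ccontr)
  assume "\<not> ?thesis"
  then obtain x y where xy: "x \<in> K" "y \<in> K" "f x < 0" "0 < f y"
    using nz by (meson linorder_neqE_linordered_idom)
  have "connected (f ` K)" using f K by (rule connected_continuous_image)
  then have "0 \<in> f ` K"
    by (rule connectedD_interval[of _ "f x" "f y"]) (use xy in auto)
  then show False using nz by force
qed

text \<open>
  A connected set that avoids the zero set of \<open>f\<close> stays on one side of it. So once both sides are
  connected, they are the components of the complement.
\<close>

lemma components_two_sides:
  fixes f :: "'a::topological_space \<Rightarrow> real"
  assumes f: "continuous_on X f"
    and C: "\<And>x. x \<in> X \<Longrightarrow> x \<in> C \<longleftrightarrow> f x = 0"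
    and pos: "connected {x \<in> X. 0 < f x}" "{x \<in> X. 0 < f x} \<noteq> {}"
    and neg: "connected {x \<in> X. f x < 0}" "{x \<in> X. f x < 0} \<noteq> {}"
  shows "components (X - C) = {{x \<in> X. 0 < f x}, {x \<in> X. f x < 0}}"
proof -
  let ?P = "{x \<in> X. 0 < f x}" and ?N = "{x \<in> X. f x < 0}"
  have sub: "?P \<subseteq> X - C" "?N \<subseteq> X - C" using C by auto
  have side: "K \<subseteq> ?P \<or> K \<subseteq> ?N" if "connected K" "K \<subseteq> X - C" for K
  proof -
    have "continuous_on K f" using f that(2) by (auto intro: continuous_on_subset)
    moreover have "\<And>x. x \<in> K \<Longrightarrow> f x \<noteq> 0" using that(2) C by auto
    ultimately show ?thesis
      using connected_nonzero_sign[OF that(1)] that(2) by fastforce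
  qed
  have disj: "?P \<inter> ?N = {}" by auto
  have "?P \<in> components (X - C)"
    unfolding in_components_maximal
  proof (intro conjI allI impI)
    fix K assume "K \<noteq> {} \<and> ?P \<subseteq> K \<and> K \<subseteq> X - C \<and> connected K"
    then show "K = ?P" using side[of K] disj pos(2) by blast
  qed (use pos sub in auto)
  moreover have "?N \<in> components (X - C)"
    unfolding in_components_maximal
  proof (intro conjI allI impI)
    fix K assume "K \<noteq> {} \<and> ?N \<subseteq> K \<and> K \<subseteq> X - C \<and> connected K"
    then show "K = ?N" using side[of K] disj neg(2) by blast
  qed (use neg sub in auto)
  moreover have "K = ?P \<or> K = ?N" if "K \<in> components (X - C)" for K
  proof -
    have K: "K \<noteq> {}" "K \<subseteq> X - C" "connected K"
      and max: "\<And>L. \<lbrakk>L \<noteq> {}; K \<subseteq> L; L \<subseteq> X - C; connected L\<rbrakk> \<Longrightarrow> L = K"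
      using that unfolding in_components_maximal by auto
    from side[OF K(3,2)] show ?thesis
    proof
      assume "K \<subseteq> ?P"
      then show ?thesis using max[OF pos(2) _ sub(1) pos(1)] by simp
    next
      assume "K \<subseteq> ?N"
      then show ?thesis using max[OF neg(2) _ sub(2) neg(1)] by simp
    qed
  qed
  ultimately show ?thesis by blast
qed

lemma inner_less_on_sphere:
  fixes a x p :: "'a::real_inner"
  assumes "x \<in> sphere a r" "p \<in> sphere a r" "x \<noteq> p"
  shows "(p - a) \<bullet> (x - a) < r\<^sup>2"
proof -
  have "norm (x - a) = r" "norm (p - a) = r"
    using assms by (auto simp: dist_norm norm_minus_commute)
  then have n: "(x - a) \<bullet> (x - a) = r\<^sup>2" "(p - a) \<bullet> (p - a) = r\<^sup>2"
    by (auto simp: dot_square_norm)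
  have "0 < (x - p) \<bullet> (x - p)" using assms(3) by simp
  also have "(x - p) \<bullet> (x - p) = (x - a) \<bullet> (x - a) - 2 * ((p - a) \<bullet> (x - a)) + (p - a) \<bullet> (p - a)"
    by (simp add: inner_diff_left inner_diff_right inner_commute)
  finally show ?thesis using n by simp
qed

lemma pole_less_on_sphere:
  fixes a x w :: "'a::real_inner"
  assumes r: "0 < r" and w: "w \<noteq> 0" and x: "x \<in> sphere a r" "x \<noteq> a + (r / norm w) *\<^sub>R w"
  shows "w \<bullet> x < w \<bullet> (a + (r / norm w) *\<^sub>R w)"
proof -
  let ?q = "a + (r / norm w) *\<^sub>R w"
  have q: "?q \<in> sphere a r" using r w by (simp add: dist_norm)
  have "(?q - a) \<bullet> (x - a) < r\<^sup>2" by (rule inner_less_on_sphere[OF x(1) q x(2)])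
  then have "w \<bullet> (x - a) < r * norm w"
    using r w by (simp add: divide_simps power2_eq_square split: if_splits)
  moreover have "w \<bullet> ?q = w \<bullet> a + r * norm w"
    using w by (simp add: inner_add_right dot_square_norm power2_eq_square)
  ultimately show ?thesis by (simp add: inner_diff_right)
qed

text \<open>
  Every point \<open>x\<close> of the cap is joined within the cap to its pole \<open>q\<close> by the meridian through \<open>x\<close>. The
  meridian is parametrised by the height \<open>t\<close> over the equator in direction of \<open>w\<close>, from the height \<open>s\<close>
  of \<open>x\<close> up to \<open>r\<close>; so the height only grows. The point \<open>y\<close> outside the cap ensures that \<open>x\<close> is
  not the opposite pole, where all meridians meet.
\<close>

lemma connected_spherical_cap:
  fixes a w :: "'a::real_inner"
  assumes r: "0 < r" and w: "w \<noteq> 0" and y: "y \<in> sphere a r" "w \<bullet> y \<le> b"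
  shows "connected {x \<in> sphere a r. b < w \<bullet> x}"
proof -
  let ?S = "{x \<in> sphere a r. b < w \<bullet> x}"
  define e where "e = w /\<^sub>R norm w"
  define q where "q = a + r *\<^sub>R e"
  have e: "e \<bullet> e = 1" using w by (simp add: e_def dot_square_norm power2_eq_square divide_simps)
  have ew: "w \<bullet> x = norm w * (e \<bullet> x)" for x using w by (simp add: e_def)
  have eq': "(r / norm w) *\<^sub>R w = r *\<^sub>R e" by (simp add: e_def divide_inverse)
  have "connected_component ?S x q" if x: "x \<in> ?S" for x
  proof (cases "x = q")
    case True
    then show ?thesis using x by simp
  next
    case False
    define s where "s = e \<bullet> (x - a)"
    define p where "p = (x - a) - s *\<^sub>R e"
    have xx: "(x - a) \<bullet> (x - a) = r\<^sup>2"
      using x by (simp add: dist_norm norm_minus_commute dot_square_norm)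
    have ep: "e \<bullet> p = 0" using e by (simp add: p_def s_def inner_diff_right)
    have pp: "p \<bullet> p = r\<^sup>2 - s\<^sup>2"
      using xx e by (simp add: p_def s_def inner_diff_left inner_diff_right inner_commute power2_eq_square)
    have "x \<noteq> a + (r / norm (- w)) *\<^sub>R (- w)"
    proof
      assume eq: "x = a + (r / norm (- w)) *\<^sub>R (- w)"
      have "y \<noteq> x" using x y by auto
      then have "- w \<bullet> y < - w \<bullet> x"
        using pole_less_on_sphere[OF r, of "- w" y a] w y(1) eq by simp
      then show False using x y by simp
    qed
    then have "- w \<bullet> x < - w \<bullet> (a + (r / norm (- w)) *\<^sub>R (- w))"
      using x w by (intro pole_less_on_sphere[OF r]) auto
    then have "norm w * (- r) < norm w * s"
      by (simp add: s_def ew eq' inner_diff_right inner_add_right e algebra_simps)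
    then have sm: "- r < s" using w by (subst (asm) mult_less_cancel_left_pos) auto
    have "w \<bullet> x < w \<bullet> (a + (r / norm w) *\<^sub>R w)"
      using x w False eq' by (intro pole_less_on_sphere[OF r]) (auto simp: q_def)
    then have "norm w * s < norm w * r"
      by (simp add: s_def ew eq' inner_diff_right inner_add_right e algebra_simps)
    then have sp: "s < r" using w by (subst (asm) mult_less_cancel_left_pos) auto
    have "0 < (r + s) * (r - s)" using sm sp by (intro mult_pos_pos) auto
    then have s2: "0 < r\<^sup>2 - s\<^sup>2" by (simp add: power2_eq_square algebra_simps)
    \<comment> \<open>At height \<open>t\<close> the horizontal component \<open>p\<close> of \<open>x\<close> has to be scaled to length \<open>sqrt (r\<^sup>2 - t\<^sup>2)\<close>.\<close>
    define c where "c = (\<lambda>t. sqrt ((r\<^sup>2 - t\<^sup>2) / (r\<^sup>2 - s\<^sup>2)))"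
    define z where "z = (\<lambda>t. a + t *\<^sub>R e + c t *\<^sub>R p)"
    have cont: "continuous_on {s..r} z"
      unfolding z_def c_def using s2 by (intro continuous_intros) auto
    have "connected (z ` {s..r})"
      by (rule connected_continuous_image[OF cont]) simp
    moreover have "z ` {s..r} \<subseteq> ?S"
    proof clarify
      fix t assume t: "t \<in> {s..r}"
      have "0 \<le> (r + t) * (r - t)" using t sm by (intro mult_nonneg_nonneg) auto
      then have t2: "0 \<le> r\<^sup>2 - t\<^sup>2" by (simp add: power2_eq_square algebra_simps)
      have c2: "c t * c t * (p \<bullet> p) = r\<^sup>2 - t\<^sup>2" using t2 s2 by (simp add: c_def pp)
      have "(z t - a) \<bullet> (z t - a) = t\<^sup>2 * (e \<bullet> e) + 2 * t * c t * (e \<bullet> p) + c t * c t * (p \<bullet> p)"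
        by (simp add: z_def inner_add_left inner_add_right inner_commute power2_eq_square)
      also have "\<dots> = r\<^sup>2" unfolding c2 by (simp add: e ep)
      finally have "norm (z t - a) = r" using r by (simp add: norm_eq_sqrt_inner)
      then have 1: "z t \<in> sphere a r" by (simp add: dist_norm norm_minus_commute)
      have "e \<bullet> (z t - a) = t" by (simp add: z_def inner_add_right e ep)
      then have "e \<bullet> (x - a) \<le> e \<bullet> (z t - a)" using t by (simp add: s_def)
      then have "w \<bullet> x \<le> w \<bullet> z t"
        by (simp add: ew inner_diff_right mult_left_mono)
      then show "z t \<in> sphere a r \<and> b < w \<bullet> z t" using 1 x by auto
    qed
    moreover have "z s = x" using s2 by (simp add: z_def c_def p_def)
    moreover have "z r = q" by (simp add: z_def c_def q_def)
    ultimately show ?thesis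
      unfolding connected_component_def using sp by (intro exI[of _ "z ` {s..r}"]) force
  qed
  then show ?thesis
    unfolding connected_iff_connected_component
    by (meson connected_component_sym connected_component_trans)
qed

section \<open>Dots on a sphere\<close>

text \<open>
  Separation in terms of functionals, for any family of circles that are zero sets of functionals with
  the two sign regions as sides. A functional with given signs on the dots need not have a circle as
  its zero set, so in the assumption \<open>realise\<close> it may be replaced by another one with the same signs.
\<close>

lemma separated_by_circle_iff_sign_cut:
  fixes v :: "'a::topological_space \<Rightarrow> 'e::real_inner"
  assumes D: "D \<subseteq> X" and A: "A \<subseteq> D" "A \<noteq> {}" "A \<noteq> D"
    and circle: "\<And>C. C \<in> \<C> \<Longrightarrow> \<exists>u. (\<forall>x\<in>X. x \<in> C \<longleftrightarrow> u \<bullet> v x = 0) \<and>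
        components (X - C) = {{x \<in> X. 0 < u \<bullet> v x}, {x \<in> X. u \<bullet> v x < 0}}"
    and realise: "\<And>u. \<lbrakk>\<forall>x\<in>A. 0 < u \<bullet> v x; \<forall>x\<in>D - A. u \<bullet> v x < 0\<rbrakk> \<Longrightarrow>
        \<exists>C\<in>\<C>. \<exists>u'. (\<forall>x\<in>A. 0 < u' \<bullet> v x) \<and> (\<forall>x\<in>D - A. u' \<bullet> v x < 0) \<and>
          (\<forall>x\<in>X. x \<in> C \<longleftrightarrow> u' \<bullet> v x = 0) \<and>
          components (X - C) = {{x \<in> X. 0 < u' \<bullet> v x}, {x \<in> X. u' \<bullet> v x < 0}}"
  shows "separated_by_circle X \<C> D A (D - A) \<longleftrightarrow> sign_cut v D {} A"
proof
  assume "separated_by_circle X \<C> D A (D - A)"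
  then obtain C U V where C: "C \<in> \<C>" "components (X - C) = {U, V}" "A = D \<inter> U" "D - A = D \<inter> V"
    unfolding separated_by_circle_def by blast
  obtain u where u: "components (X - C) = {{x \<in> X. 0 < u \<bullet> v x}, {x \<in> X. u \<bullet> v x < 0}}"
    using circle[OF C(1)] by blast
  then have "U = {x \<in> X. 0 < u \<bullet> v x} \<and> V = {x \<in> X. u \<bullet> v x < 0} \<or>
      U = {x \<in> X. u \<bullet> v x < 0} \<and> V = {x \<in> X. 0 < u \<bullet> v x}"
    using C(2) by (simp add: doubleton_eq_iff)
  then show "sign_cut v D {} A"
  proof
    assume UV: "U = {x \<in> X. 0 < u \<bullet> v x} \<and> V = {x \<in> X. u \<bullet> v x < 0}"
    have "0 < u \<bullet> v x" if "x \<in> A" for x using that C(3) UV by auto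
    moreover have "u \<bullet> v x < 0" if "x \<in> D - A" for x using that C(4) UV by auto
    ultimately show ?thesis unfolding sign_cut_def by (intro exI[of _ u]) simp
  next
    assume UV: "U = {x \<in> X. u \<bullet> v x < 0} \<and> V = {x \<in> X. 0 < u \<bullet> v x}"
    have "u \<bullet> v x < 0" if "x \<in> A" for x using that C(3) UV by auto
    moreover have "0 < u \<bullet> v x" if "x \<in> D - A" for x using that C(4) UV by auto
    ultimately show ?thesis unfolding sign_cut_def by (intro exI[of _ "- u"]) simp
  qed
next
  assume "sign_cut v D {} A"
  then obtain u where u: "\<forall>x\<in>A. 0 < u \<bullet> v x" "\<forall>x\<in>D - A. u \<bullet> v x < 0"
    by (auto simp: sign_cut_def)
  obtain C w where C: "C \<in> \<C>" and w: "\<forall>x\<in>A. 0 < w \<bullet> v x" "\<forall>x\<in>D - A. w \<bullet> v x < 0"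
      "\<forall>x\<in>X. x \<in> C \<longleftrightarrow> w \<bullet> v x = 0"
      "components (X - C) = {{x \<in> X. 0 < w \<bullet> v x}, {x \<in> X. w \<bullet> v x < 0}}"
    using realise[OF u] by (elim bexE exE conjE) (rule that)
  have sgn: "(0 < w \<bullet> v x \<longleftrightarrow> x \<in> A) \<and> (w \<bullet> v x < 0 \<longleftrightarrow> x \<notin> A) \<and> w \<bullet> v x \<noteq> 0" if "x \<in> D" for x
    using bspec[OF w(1), of x] bspec[OF w(2), of x] that by (cases "x \<in> A") auto
  obtain x where x: "x \<in> A" using A(2) by blast
  show "separated_by_circle X \<C> D A (D - A)"
    unfolding separated_by_circle_def
  proof (intro bexI[OF _ C] conjI exI)
    show "C \<inter> D = {}" using sgn w(3) D by blast
    have "x \<in> {x \<in> X. 0 < w \<bullet> v x}" "x \<notin> {x \<in> X. w \<bullet> v x < 0}"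
      using x sgn[of x] A(1) D by auto
    then show "{x \<in> X. 0 < w \<bullet> v x} \<noteq> {x \<in> X. w \<bullet> v x < 0}" by blast
    show "components (X - C) = {{x \<in> X. 0 < w \<bullet> v x}, {x \<in> X. w \<bullet> v x < 0}}" by (fact w(4))
    show "A = D \<inter> {x \<in> X. 0 < w \<bullet> v x}" "D - A = D \<inter> {x \<in> X. w \<bullet> v x < 0}"
      using sgn A(1) D by auto
  qed
qed

text \<open>
  Affine functions on the ambient space become linear functionals. Planes are the zero sets.
\<close>

definition affine_lift :: "'a::euclidean_space \<Rightarrow> 'a \<times> real" where
  "affine_lift x = (x, 1)"

lemma inner_affine_lift: "(w, c) \<bullet> affine_lift x = w \<bullet> x + c"
  by (simp add: affine_lift_def)

text \<open>
  As the plane contains two points of the sphere, it is not tangent: each of the two poles of the sphere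
  in direction of the normal \<open>w\<close> differs from one of these points, hence lies strictly on its own side.
\<close>

lemma components_sphere_minus_circle:
  fixes a w :: "'a::euclidean_space"
  assumes r: "0 < r" and w: "w \<noteq> 0"
    and xy: "x \<in> sphere a r" "y \<in> sphere a r" "w \<bullet> x + c = 0" "w \<bullet> y + c = 0" "x \<noteq> y"
  shows "components (sphere a r - sphere a r \<inter> {z. w \<bullet> z + c = 0}) =
    {{z \<in> sphere a r. 0 < w \<bullet> z + c}, {z \<in> sphere a r. w \<bullet> z + c < 0}}"
proof (rule components_two_sides)
  let ?q = "\<lambda>w. a + (r / norm w) *\<^sub>R w"
  have pole: "?q w \<in> sphere a r \<and> w \<bullet> x < w \<bullet> ?q w"
    if w: "w \<noteq> 0" and eq: "w \<bullet> x = w \<bullet> y" for w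
  proof
    show "?q w \<in> sphere a r" using r w by (simp add: dist_norm)
    show "w \<bullet> x < w \<bullet> ?q w"
    proof (cases "x = ?q w")
      case True
      then have "w \<bullet> y < w \<bullet> ?q w"
        using xy(5) by (intro pole_less_on_sphere[OF r w xy(2)]) simp
      then show ?thesis using eq by simp
    qed (rule pole_less_on_sphere[OF r w xy(1)])
  qed
  have p1: "?q w \<in> sphere a r" "w \<bullet> x < w \<bullet> ?q w"
    using pole[of w] w xy by simp_all
  have p2: "?q (- w) \<in> sphere a r" "w \<bullet> ?q (- w) < w \<bullet> x"
    using pole[of "- w"] w xy by simp_all
  show "{z \<in> sphere a r. 0 < w \<bullet> z + c} \<noteq> {}"
    using p1 xy(3) by (intro ex_in_conv[THEN iffD1] exI[of _ "?q w"]) simp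
  show "{z \<in> sphere a r. w \<bullet> z + c < 0} \<noteq> {}"
    using p2 xy(3) by (intro ex_in_conv[THEN iffD1] exI[of _ "?q (- w)"]) simp
  have "connected {z \<in> sphere a r. - c < w \<bullet> z}"
    by (rule connected_spherical_cap[OF r w xy(1)]) (use xy in simp)
  moreover have "- c < w \<bullet> z \<longleftrightarrow> 0 < w \<bullet> z + c" for z by linarith
  ultimately show "connected {z \<in> sphere a r. 0 < w \<bullet> z + c}" by simp
  have "connected {z \<in> sphere a r. c < - w \<bullet> z}"
    by (rule connected_spherical_cap[OF r _ xy(1)]) (use xy w in simp_all)
  moreover have "c < - w \<bullet> z \<longleftrightarrow> w \<bullet> z + c < 0" for z by (simp add: inner_minus_left) linarith
  ultimately show "connected {z \<in> sphere a r. w \<bullet> z + c < 0}" by simp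
qed (auto intro!: continuous_intros)

text \<open>
  The hyperplane has distance \<open>\<bar>h\<bar> < r\<close> from the centre, because it separates two points of the sphere.
  Two points of intersection lie opposite to each other at distance \<open>sqrt (r\<^sup>2 - h\<^sup>2)\<close> from the foot \<open>m\<close> of
  the perpendicular.
\<close>

lemma hyperplane_meets_sphere_twice:
  fixes a w :: "'a::euclidean_space"
  assumes dim: "2 \<le> DIM('a)" and r: "0 < r" and w: "w \<noteq> 0"
    and p: "p \<in> sphere a r" "0 < w \<bullet> p + c" and q: "q \<in> sphere a r" "w \<bullet> q + c < 0"
  shows "\<exists>x y. x \<in> sphere a r \<and> y \<in> sphere a r \<and> w \<bullet> x + c = 0 \<and> w \<bullet> y + c = 0 \<and> x \<noteq> y"
proof -
  obtain u' where u': "u' \<noteq> 0" "w \<bullet> u' = 0"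
    using orthogonal_to_vector_exists[OF dim, of w] by (auto simp: orthogonal_def)
  define u where "u = u' /\<^sub>R norm u'"
  have u: "u \<bullet> u = 1" "w \<bullet> u = 0"
    using u' by (simp_all add: u_def dot_square_norm power2_eq_square divide_simps)
  define h where "h = - (w \<bullet> a + c) / norm w"
  have "w \<bullet> (p - a) \<le> norm w * r"
    using Cauchy_Schwarz_ineq2[of w "p - a"] p(1) by (simp add: dist_norm norm_minus_commute)
  then have h1: "h < r" using p(2) w by (simp add: h_def divide_simps inner_diff_right algebra_simps)
  have "- (w \<bullet> (q - a)) \<le> norm w * r"
    using Cauchy_Schwarz_ineq2[of w "q - a"] q(1) by (simp add: dist_norm norm_minus_commute)
  then have h2: "- r < h" using q(2) w by (simp add: h_def divide_simps inner_diff_right algebra_simps)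
  have "0 < (r + h) * (r - h)" using h1 h2 by (intro mult_pos_pos) auto
  then have rh: "0 < r\<^sup>2 - h\<^sup>2" by (simp add: power2_eq_square algebra_simps)
  define m where "m = a + (h / norm w) *\<^sub>R w"
  have mw: "w \<bullet> m + c = 0"
    using w by (simp add: m_def h_def inner_add_right dot_square_norm power2_eq_square)
  have "(m - a) \<bullet> (m - a) = h\<^sup>2"
    using w by (simp add: m_def dot_square_norm power_divide flip: power_mult_distrib)
  moreover have "(m - a) \<bullet> u = 0" by (simp add: m_def u(2))
  ultimately have on: "m + t *\<^sub>R u \<in> sphere a r" if "t\<^sup>2 = r\<^sup>2 - h\<^sup>2" for t
  proof -
    assume *: "(m - a) \<bullet> (m - a) = h\<^sup>2" "(m - a) \<bullet> u = 0"
    have "(m + t *\<^sub>R u - a) \<bullet> (m + t *\<^sub>R u - a) = (m - a) \<bullet> (m - a) + 2 * t * ((m - a) \<bullet> u) + t\<^sup>2 * (u \<bullet> u)"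
      by (simp add: inner_add_left inner_add_right inner_diff_left inner_diff_right inner_commute
          power2_eq_square algebra_simps)
    also have "\<dots> = r\<^sup>2" using * that u(1) by simp
    finally have "norm (m + t *\<^sub>R u - a) = r" using r by (simp add: norm_eq_sqrt_inner)
    then show ?thesis by (simp add: dist_norm norm_minus_commute)
  qed
  let ?s = "sqrt (r\<^sup>2 - h\<^sup>2)"
  have s: "0 < ?s" using rh by simp
  have "m + ?s *\<^sub>R u \<noteq> m + (- ?s) *\<^sub>R u"
  proof
    assume "m + ?s *\<^sub>R u = m + (- ?s) *\<^sub>R u"
    then have "(2 * ?s) *\<^sub>R u = 0" by (simp add: scaleR_2 algebra_simps flip: scaleR_scaleR)
    then show False using s u(1) by auto
  qed
  moreover have "m + ?s *\<^sub>R u \<in> sphere a r" "m + (- ?s) *\<^sub>R u \<in> sphere a r"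
    using rh by (intro on; simp)+
  moreover have "w \<bullet> (m + t *\<^sub>R u) + c = 0" for t
    using mw by (simp add: inner_add_right u(2))
  ultimately show ?thesis by blast
qed

lemma sphere_circles_iff:
  "C \<in> sphere_circles a r \<longleftrightarrow> (\<exists>w c. w \<noteq> 0 \<and> C = sphere a r \<inter> {z. w \<bullet> z + c = 0} \<and>
     (\<exists>x\<in>C. \<exists>y\<in>C. x \<noteq> y))"
proof
  assume "C \<in> sphere_circles a r"
  then obtain P where P: "C = sphere a r \<inter> P" "affine P" "aff_dim P = 2" "\<exists>x\<in>C. \<exists>y\<in>C. x \<noteq> y"
    unfolding sphere_circles_def by blast
  then obtain w b where "w \<noteq> 0" "P = {z. w \<bullet> z = b}"
    using aff_dim_eq_hyperplane[of P] by (auto simp: hull_same)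
  then show "\<exists>w c. w \<noteq> 0 \<and> C = sphere a r \<inter> {z. w \<bullet> z + c = 0} \<and> (\<exists>x\<in>C. \<exists>y\<in>C. x \<noteq> y)"
    using P by (intro exI[of _ w] exI[of _ "- b"]) auto
next
  assume "\<exists>w c. w \<noteq> 0 \<and> C = sphere a r \<inter> {z. w \<bullet> z + c = 0} \<and> (\<exists>x\<in>C. \<exists>y\<in>C. x \<noteq> y)"
  then obtain w c where w: "w \<noteq> 0" "C = sphere a r \<inter> {z. w \<bullet> z + c = 0}" "\<exists>x\<in>C. \<exists>y\<in>C. x \<noteq> y"
    by blast
  have eq: "{z. w \<bullet> z + c = 0} = {z. w \<bullet> z = - c}" by auto
  show "C \<in> sphere_circles a r"
    unfolding sphere_circles_def mem_Collect_eq
    by (intro exI[of _ "{z. w \<bullet> z = - c}"] conjI)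
      (use w affine_hyperplane in \<open>auto simp: eq aff_dim_hyperplane\<close>)
qed

lemma card_4_two_points:
  assumes "card S = 4" shows "\<exists>x\<in>S. \<exists>y\<in>S. x \<noteq> y"
proof (rule ccontr)
  assume "\<not> ?thesis"
  then have "\<forall>x\<in>S. \<forall>y\<in>S. x = y" by blast
  moreover have "finite S" using assms by (metis card.infinite zero_neq_numeral)
  ultimately have "card S \<le> Suc 0" by (simp add: card_le_Suc0_iff_eq)
  then show False using assms by simp
qed

lemma card_separable_partitions_sphere:
  fixes a :: "real ^ 3"
  assumes r: "0 < r" and D: "D \<subseteq> sphere a r" "finite D" "3 \<le> card D"
    and gp: "general_position_sphere a r D"
    and kl: "1 \<le> k" "1 \<le> l" "card D = k + l"
  shows "int (card (separable_partitions (sphere a r) (sphere_circles a r) D k l)) =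
     (if k \<noteq> l then 2 * int k * int l - int k - int l + 2 else (int k)\<^sup>2 - int k + 1)"
proof (rule card_separable_partitions[where v = affine_lift])
  show "DIM((real ^ 3) \<times> real) = 4" by simp
  show "spanning_quadruples affine_lift D"
    unfolding spanning_quadruples_def
  proof (intro allI impI)
    fix S and u :: "(real ^ 3) \<times> real"
    assume S: "S \<subseteq> D" "card S = 4" and zero: "\<forall>i\<in>S. u \<bullet> affine_lift i = 0"
    obtain w c where u: "u = (w, c)" by fastforce
    have two: "\<exists>x\<in>S. \<exists>y\<in>S. x \<noteq> y" using card_4_two_points[OF S(2)] .
    have zero': "w \<bullet> x + c = 0" if "x \<in> S" for x
      using zero that by (simp add: u inner_affine_lift)
    have w: "w = 0"
    proof (rule ccontr)
      assume "w \<noteq> 0"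
      have sub: "S \<subseteq> sphere a r \<inter> {z. w \<bullet> z + c = 0}" using S D zero' by auto
      then have "sphere a r \<inter> {z. w \<bullet> z + c = 0} \<in> sphere_circles a r"
        unfolding sphere_circles_iff using \<open>w \<noteq> 0\<close> two by blast
      then show False
        using gp S sub unfolding general_position_sphere_def no_four_on_circle_def by blast
    qed
    then have "c = 0" using two zero' by auto
    then show "u = 0" using w by (simp add: u zero_prod_def)
  qed
  show "convex_configuration affine_lift D"
    unfolding convex_configuration_def
  proof (intro conjI ballI)
    show "\<exists>u. \<forall>i\<in>D. 0 < u \<bullet> affine_lift i"
      by (rule exI[of _ "(0, 1)"]) (simp add: inner_affine_lift)
  next
    fix p assume p: "p \<in> D"
    \<comment> \<open>The tangent plane of the sphere at \<open>p\<close>.\<close>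
    have eq: "(p - a, - ((p - a) \<bullet> a) - r\<^sup>2) \<bullet> affine_lift x = (p - a) \<bullet> (x - a) - r\<^sup>2" for x
      by (simp add: inner_affine_lift inner_diff_right)
    have "norm (p - a) = r" using p D by (auto simp: dist_norm norm_minus_commute)
    then have "(p - a, - ((p - a) \<bullet> a) - r\<^sup>2) \<bullet> affine_lift p = 0"
      unfolding eq by (simp add: dot_square_norm)
    moreover have "(p - a, - ((p - a) \<bullet> a) - r\<^sup>2) \<bullet> affine_lift x < 0" if "x \<in> D - {p}" for x
    proof -
      have "(p - a) \<bullet> (x - a) < r\<^sup>2"
        by (rule inner_less_on_sphere) (use p D that in auto)
      then show ?thesis unfolding eq by simp
    qed
    ultimately show "\<exists>u. u \<bullet> affine_lift p = 0 \<and> (\<forall>i\<in>D - {p}. u \<bullet> affine_lift i < 0)"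
      by blast
  qed
  fix A assume A: "A \<subseteq> D" "A \<noteq> {}" "A \<noteq> D"
  show "separated_by_circle (sphere a r) (sphere_circles a r) D A (D - A) \<longleftrightarrow> sign_cut affine_lift D {} A"
  proof (rule separated_by_circle_iff_sign_cut[OF D(1) A])
    fix C assume "C \<in> sphere_circles a r"
    then obtain w c x y where w: "w \<noteq> 0" "C = sphere a r \<inter> {z. w \<bullet> z + c = 0}" "x \<in> C" "y \<in> C" "x \<noteq> y"
      unfolding sphere_circles_iff by blast
    have "components (sphere a r - C) =
        {{z \<in> sphere a r. 0 < w \<bullet> z + c}, {z \<in> sphere a r. w \<bullet> z + c < 0}}"
      unfolding w(2) by (rule components_sphere_minus_circle[OF r w(1), of x a y]) (use w in auto)
    moreover have "\<forall>x\<in>sphere a r. x \<in> C \<longleftrightarrow> w \<bullet> x + c = 0" using w(2) by blast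
    ultimately show "\<exists>u. (\<forall>x\<in>sphere a r. x \<in> C \<longleftrightarrow> u \<bullet> affine_lift x = 0) \<and>
        components (sphere a r - C) =
          {{x \<in> sphere a r. 0 < u \<bullet> affine_lift x}, {x \<in> sphere a r. u \<bullet> affine_lift x < 0}}"
      by (intro exI[of _ "(w, c)"]) (simp add: inner_affine_lift)
  next
    fix u :: "(real ^ 3) \<times> real"
    assume pos: "\<forall>x\<in>A. 0 < u \<bullet> affine_lift x" and neg: "\<forall>x\<in>D - A. u \<bullet> affine_lift x < 0"
    obtain w c where u: "u = (w, c)" by fastforce
    obtain p q where pq: "p \<in> A" "q \<in> D - A" using A by blast
    have p: "0 < w \<bullet> p + c" and q: "w \<bullet> q + c < 0"
      using pos neg pq by (auto simp: u inner_affine_lift)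
    have w: "w \<noteq> 0" using p q by auto
    have pS: "p \<in> sphere a r" "q \<in> sphere a r" using pq A D by auto
    obtain x y where xy: "x \<in> sphere a r" "y \<in> sphere a r" "w \<bullet> x + c = 0" "w \<bullet> y + c = 0" "x \<noteq> y"
      using hyperplane_meets_sphere_twice[OF _ r w pS(1) p pS(2) q] by auto
    let ?C = "sphere a r \<inter> {z. w \<bullet> z + c = 0}"
    have C: "?C \<in> sphere_circles a r"
      unfolding sphere_circles_iff using w xy by blast
    show "\<exists>C\<in>sphere_circles a r. \<exists>u'. (\<forall>x\<in>A. 0 < u' \<bullet> affine_lift x) \<and>
        (\<forall>x\<in>D - A. u' \<bullet> affine_lift x < 0) \<and>
        (\<forall>x\<in>sphere a r. x \<in> C \<longleftrightarrow> u' \<bullet> affine_lift x = 0) \<and>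
        components (sphere a r - C) =
          {{x \<in> sphere a r. 0 < u' \<bullet> affine_lift x}, {x \<in> sphere a r. u' \<bullet> affine_lift x < 0}}"
    proof (intro bexI[OF _ C] exI[of _ u] conjI pos neg)
      show "\<forall>x\<in>sphere a r. x \<in> ?C \<longleftrightarrow> u \<bullet> affine_lift x = 0"
        by (simp add: u inner_affine_lift)
      show "components (sphere a r - ?C) =
          {{x \<in> sphere a r. 0 < u \<bullet> affine_lift x}, {x \<in> sphere a r. u \<bullet> affine_lift x < 0}}"
        unfolding u inner_affine_lift by (rule components_sphere_minus_circle[OF r w xy])
    qed
  qed
qed (use D kl in auto)

section \<open>Dots in the plane\<close>

text \<open>
  The lift of the plane to a paraboloid, followed by the affine lift. Circles and lines are the zero sets
  of functionals; lines are those with coefficient zero at \<open>x \<bullet> x\<close>.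
\<close>

definition paraboloid_lift :: "'a::euclidean_space \<Rightarrow> ('a \<times> real) \<times> real" where
  "paraboloid_lift x = ((x, x \<bullet> x), 1)"

lemma inner_paraboloid_lift: "((w, s), c) \<bullet> paraboloid_lift x = w \<bullet> x + s * (x \<bullet> x) + c"
  by (simp add: paraboloid_lift_def)

text \<open>
  Completing the square: \<open>z\<close> is the centre and \<open>z \<bullet> z - c / s\<close> the squared radius of the circle on which the
  functional vanishes.
\<close>

lemma inner_paraboloid_lift_centre:
  fixes w x :: "'a::euclidean_space" and s c :: real
  assumes "s \<noteq> 0"
  defines "z \<equiv> - (1 / (2 * s)) *\<^sub>R w"
  shows "((w, s), c) \<bullet> paraboloid_lift x = s * ((dist z x)\<^sup>2 - (z \<bullet> z - c / s))"
proof -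
  have "(dist z x)\<^sup>2 = (z - x) \<bullet> (z - x)" by (simp add: dist_norm dot_square_norm)
  also have "\<dots> = z \<bullet> z - 2 * (z \<bullet> x) + x \<bullet> x"
    by (simp add: inner_diff_left inner_diff_right inner_commute)
  finally have d: "(dist z x)\<^sup>2 = z \<bullet> z - 2 * (z \<bullet> x) + x \<bullet> x" .
  have "s * ((dist z x)\<^sup>2 - (z \<bullet> z - c / s)) = - 2 * s * (z \<bullet> x) + s * (x \<bullet> x) + c"
    unfolding d using assms(1) by (simp add: algebra_simps)
  moreover have "- 2 * s * (z \<bullet> x) = w \<bullet> x"
    using assms(1) by (simp add: z_def)
  ultimately show ?thesis by (simp add: inner_paraboloid_lift)
qed

lemma components_complement_sphere:
  fixes z :: "'a::euclidean_space"
  assumes dim: "2 \<le> DIM('a)" and \<rho>: "0 < \<rho>" and s: "s \<noteq> 0"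
    and f: "\<And>x. f x = s * ((dist z x)\<^sup>2 - \<rho>\<^sup>2)"
  shows "components (UNIV - sphere z \<rho>) = {{x \<in> UNIV. 0 < f x}, {x \<in> UNIV. f x < 0}}"
proof -
  have sq: "\<rho>\<^sup>2 < (dist z x)\<^sup>2 \<longleftrightarrow> \<rho> < dist z x" "(dist z x)\<^sup>2 < \<rho>\<^sup>2 \<longleftrightarrow> dist z x < \<rho>"
    "(dist z x)\<^sup>2 = \<rho>\<^sup>2 \<longleftrightarrow> dist z x = \<rho>" for x
    using \<rho> by (simp_all add: power2_eq_iff_nonneg flip: not_le)
  have outside: "{x. \<rho> < dist z x} = - cball z \<rho>" and inside: "{x. dist z x < \<rho>} = ball z \<rho>"
    by auto
  have con: "connected {x. \<rho> < dist z x}" "connected {x. dist z x < \<rho>}"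
    unfolding outside inside using dim by (simp_all add: connected_complement_bounded_convex)
  obtain y where "y \<notin> cball z \<rho>"
    using bounded_cball[of z \<rho>] not_bounded_UNIV by (metis UNIV_eq_I)
  then have ne: "{x. \<rho> < dist z x} \<noteq> {}" "{x. dist z x < \<rho>} \<noteq> {}"
    using \<rho> unfolding outside inside by auto
  show ?thesis
  proof (rule components_two_sides)
    show "continuous_on UNIV f" unfolding f by (intro continuous_intros)
    show "x \<in> sphere z \<rho> \<longleftrightarrow> f x = 0" for x using s by (simp add: f sq)
    consider "0 < s" | "s < 0" using s by linarith
    then have "{x \<in> UNIV. 0 < f x} = {x. \<rho> < dist z x} \<and> {x \<in> UNIV. f x < 0} = {x. dist z x < \<rho>} \<or>
        {x \<in> UNIV. 0 < f x} = {x. dist z x < \<rho>} \<and> {x \<in> UNIV. f x < 0} = {x. \<rho> < dist z x}"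
      by cases (simp_all add: f zero_less_mult_iff mult_less_0_iff sq)
    then show "connected {x \<in> UNIV. 0 < f x}" "{x \<in> UNIV. 0 < f x} \<noteq> {}"
      "connected {x \<in> UNIV. f x < 0}" "{x \<in> UNIV. f x < 0} \<noteq> {}"
      using con ne by auto
  qed
qed

lemma card_separable_partitions_plane:
  fixes D :: "(real ^ 2) set"
  assumes D: "finite D" "3 \<le> card D" and gp: "general_position_plane D"
    and kl: "1 \<le> k" "1 \<le> l" "card D = k + l"
  shows "int (card (separable_partitions UNIV plane_circles D k l)) =
     (if k \<noteq> l then 2 * int k * int l - int k - int l + 2 else (int k)\<^sup>2 - int k + 1)"
proof (rule card_separable_partitions[where v = paraboloid_lift])
  show "DIM(((real ^ 2) \<times> real) \<times> real) = 4" by simp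
  show "spanning_quadruples paraboloid_lift D"
    unfolding spanning_quadruples_def
  proof (intro allI impI)
    fix S and u :: "((real ^ 2) \<times> real) \<times> real"
    assume S: "S \<subseteq> D" "card S = 4" and zero: "\<forall>i\<in>S. u \<bullet> paraboloid_lift i = 0"
    obtain w s c where u: "u = ((w, s), c)" by (metis surj_pair)
    obtain x y where xy: "x \<in> S" "y \<in> S" "x \<noteq> y" using card_4_two_points[OF S(2)] by blast
    have s: "s = 0"
    proof (rule ccontr)
      assume "s \<noteq> 0"
      define z where "z = - (1 / (2 * s)) *\<^sub>R w"
      define R where "R = z \<bullet> z - c / s"
      have R: "(dist z x)\<^sup>2 = R" if "x \<in> S" for x
      proof -
        have "s * ((dist z x)\<^sup>2 - R) = 0"
          using inner_paraboloid_lift_centre[OF \<open>s \<noteq> 0\<close>, of w c x] zero that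
          by (simp add: u z_def R_def)
        then show ?thesis using \<open>s \<noteq> 0\<close> by simp
      qed
      have "z \<noteq> x \<or> z \<noteq> y" using xy(3) by auto
      then have "0 < R" using R[OF xy(1)] R[OF xy(2)] by (metis zero_less_power2 dist_eq_0_iff)
      moreover have "S \<subseteq> sphere z (sqrt R)"
      proof
        fix x assume "x \<in> S"
        then have "sqrt R = dist z x" using R by (metis real_sqrt_abs abs_of_nonneg zero_le_dist)
        then show "x \<in> sphere z (sqrt R)" by simp
      qed
      moreover have "sphere z (sqrt R) \<in> plane_circles"
        using \<open>0 < R\<close> unfolding plane_circles_def by (intro CollectI exI[of _ z] exI[of _ "sqrt R"]) simp
      ultimately show False
        using gp S unfolding general_position_plane_def no_four_on_circle_def by blast
    qed
    have line: "w \<bullet> x + c = 0" if "x \<in> S" for x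
      using zero that by (simp add: u s inner_paraboloid_lift)
    have w: "w = 0"
    proof (rule ccontr)
      assume "w \<noteq> 0"
      obtain T where T: "T \<subseteq> S" "card T = 3"
        using obtain_subset_with_card_n[of 3 S] S(2) by auto
      have "T \<subseteq> {x. w \<bullet> x = - c}" using T(1) line by (force simp: eq_neg_iff_add_eq_0)
      then have "aff_dim T \<le> aff_dim {x. w \<bullet> x = - c}" by (rule aff_dim_subset)
      also have "\<dots> = 1" using \<open>w \<noteq> 0\<close> by simp
      finally have "collinear T" by (simp add: collinear_aff_dim)
      then show False using gp S(1) T unfolding general_position_plane_def by blast
    qed
    have "c = 0" using line[OF xy(1)] w by simp
    then show "u = 0" using w s by (simp add: u zero_prod_def)
  qed
  show "convex_configuration paraboloid_lift D"
    unfolding convex_configuration_def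
  proof (intro conjI ballI)
    show "\<exists>u. \<forall>i\<in>D. 0 < u \<bullet> paraboloid_lift i"
      by (rule exI[of _ "((0, 0), 1)"]) (simp add: inner_paraboloid_lift)
  next
    fix p assume p: "p \<in> D"
    \<comment> \<open>The tangent hyperplane of the paraboloid over \<open>p\<close>.\<close>
    have eq: "((2 *\<^sub>R p, - 1), - (p \<bullet> p)) \<bullet> paraboloid_lift x = - ((x - p) \<bullet> (x - p))" for x
      unfolding inner_paraboloid_lift by (simp add: inner_diff_left inner_diff_right inner_commute)
    show "\<exists>u. u \<bullet> paraboloid_lift p = 0 \<and> (\<forall>i\<in>D - {p}. u \<bullet> paraboloid_lift i < 0)"
      by (rule exI[of _ "((2 *\<^sub>R p, - 1), - (p \<bullet> p))"]) (simp add: eq)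
  qed
  fix A assume A: "A \<subseteq> D" "A \<noteq> {}" "A \<noteq> D"
  show "separated_by_circle UNIV plane_circles D A (D - A) \<longleftrightarrow> sign_cut paraboloid_lift D {} A"
  proof (rule separated_by_circle_iff_sign_cut[OF _ A])
    fix C :: "(real ^ 2) set" assume "C \<in> plane_circles"
    then obtain z \<rho> where C: "C = sphere z \<rho>" "0 < \<rho>" unfolding plane_circles_def by blast
    let ?u = "((- 2 *\<^sub>R z, 1), z \<bullet> z - \<rho>\<^sup>2)"
    have eq: "?u \<bullet> paraboloid_lift x = 1 * ((dist z x)\<^sup>2 - \<rho>\<^sup>2)" for x
      using inner_paraboloid_lift_centre[of 1 "- 2 *\<^sub>R z" "z \<bullet> z - \<rho>\<^sup>2" x] by simp
    have "components (UNIV - C) =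
        {{x \<in> UNIV. 0 < ?u \<bullet> paraboloid_lift x}, {x \<in> UNIV. ?u \<bullet> paraboloid_lift x < 0}}"
      unfolding C(1) by (rule components_complement_sphere[OF _ C(2) _ eq]) simp_all
    moreover have "x \<in> C \<longleftrightarrow> ?u \<bullet> paraboloid_lift x = 0" for x
      unfolding eq C(1) using C(2) by (simp add: power2_eq_iff_nonneg)
    ultimately show "\<exists>u. (\<forall>x\<in>UNIV. x \<in> C \<longleftrightarrow> u \<bullet> paraboloid_lift x = 0) \<and>
        components (UNIV - C) =
          {{x \<in> UNIV. 0 < u \<bullet> paraboloid_lift x}, {x \<in> UNIV. u \<bullet> paraboloid_lift x < 0}}"
      by (intro exI[of _ ?u] conjI ballI)
  next
    fix u :: "((real ^ 2) \<times> real) \<times> real"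
    assume pos: "\<forall>x\<in>A. 0 < u \<bullet> paraboloid_lift x" and neg: "\<forall>x\<in>D - A. u \<bullet> paraboloid_lift x < 0"
    obtain w s\<^sub>0 c where u: "u = ((w, s\<^sub>0), c)" by (metis surj_pair)
    \<comment> \<open>A separating line is bent into a circle, by a small coefficient at \<open>x \<bullet> x\<close>.\<close>
    obtain \<epsilon> where \<epsilon>: "0 < \<epsilon>" "\<forall>x\<in>D. u \<bullet> paraboloid_lift x \<noteq> 0 \<longrightarrow> \<epsilon> * \<bar>x \<bullet> x\<bar> < \<bar>u \<bullet> paraboloid_lift x\<bar>"
      using small_perturbation[OF D(1), of "\<lambda>x. u \<bullet> paraboloid_lift x" "\<lambda>x. x \<bullet> x"] by blast
    define s where "s = (if s\<^sub>0 = 0 then \<epsilon> else s\<^sub>0)"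
    have s: "s \<noteq> 0" using \<epsilon>(1) by (simp add: s_def)
    define f where "f = (\<lambda>x. ((w, s), c) \<bullet> paraboloid_lift x)"
    have f: "f x = u \<bullet> paraboloid_lift x + (s - s\<^sub>0) * (x \<bullet> x)" for x
      by (simp add: f_def u inner_paraboloid_lift algebra_simps)
    have close: "\<bar>(s - s\<^sub>0) * (x \<bullet> x)\<bar> < \<bar>u \<bullet> paraboloid_lift x\<bar>"
      if "x \<in> D" "u \<bullet> paraboloid_lift x \<noteq> 0" for x
      using \<epsilon> that by (auto simp: s_def abs_mult)
    have fpos: "0 < f x" if "x \<in> A" for x
    proof -
      have "x \<in> D" "0 < u \<bullet> paraboloid_lift x" using that A(1) pos by auto
      then show ?thesis using close[of x] unfolding f by linarith
    qed
    have fneg: "f x < 0" if "x \<in> D - A" for x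
    proof -
      have "x \<in> D" "u \<bullet> paraboloid_lift x < 0" using that neg by auto
      then show ?thesis using close[of x] unfolding f by linarith
    qed
    define z where "z = - (1 / (2 * s)) *\<^sub>R w"
    define R where "R = z \<bullet> z - c / s"
    have fz: "f x = s * ((dist z x)\<^sup>2 - R)" for x
      unfolding f_def z_def R_def by (rule inner_paraboloid_lift_centre[OF s])
    \<comment> \<open>Otherwise \<open>f\<close> would not take both signs, but both parts of the partition are non-empty.\<close>
    have "0 < R"
    proof (rule ccontr)
      assume "\<not> 0 < R"
      then have nn: "0 \<le> (dist z x)\<^sup>2 - R" for x by (smt (verit) zero_le_power2)
      obtain p q where pq: "p \<in> A" "q \<in> D - A" using A by blast
      show False
      proof (cases "0 < s")
        case True
        then have "0 \<le> f q" unfolding fz using nn by (intro mult_nonneg_nonneg) auto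
        then show False using fneg[OF pq(2)] by simp
      next
        case False
        then have "f p \<le> 0" unfolding fz using nn by (intro mult_nonpos_nonneg) auto
        then show False using fpos[OF pq(1)] by simp
      qed
    qed
    define \<rho> where "\<rho> = sqrt R"
    have \<rho>: "0 < \<rho>" "R = \<rho>\<^sup>2" using \<open>0 < R\<close> by (simp_all add: \<rho>_def)
    have C: "sphere z \<rho> \<in> plane_circles"
      using \<rho>(1) unfolding plane_circles_def by blast
    show "\<exists>C\<in>plane_circles. \<exists>u'. (\<forall>x\<in>A. 0 < u' \<bullet> paraboloid_lift x) \<and>
        (\<forall>x\<in>D - A. u' \<bullet> paraboloid_lift x < 0) \<and>
        (\<forall>x\<in>UNIV. x \<in> C \<longleftrightarrow> u' \<bullet> paraboloid_lift x = 0) \<and>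
        components (UNIV - C) =
          {{x \<in> UNIV. 0 < u' \<bullet> paraboloid_lift x}, {x \<in> UNIV. u' \<bullet> paraboloid_lift x < 0}}"
    proof (intro bexI[OF _ C] exI[of _ "((w, s), c)"] conjI ballI)
      show "0 < ((w, s), c) \<bullet> paraboloid_lift x" if "x \<in> A" for x
        using fpos[OF that] by (simp add: f_def)
      show "((w, s), c) \<bullet> paraboloid_lift x < 0" if "x \<in> D - A" for x
        using fneg[OF that] by (simp add: f_def)
      show "x \<in> sphere z \<rho> \<longleftrightarrow> ((w, s), c) \<bullet> paraboloid_lift x = 0" for x
        using fz[of x] s \<rho> by (simp add: f_def power2_eq_iff_nonneg)
      show "components (UNIV - sphere z \<rho>) = {{x \<in> UNIV. 0 < ((w, s), c) \<bullet> paraboloid_lift x},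
          {x \<in> UNIV. ((w, s), c) \<bullet> paraboloid_lift x < 0}}"
        by (rule components_complement_sphere[OF _ \<rho>(1) s]) (use fz \<rho>(2) in \<open>simp_all add: f_def\<close>)
    qed
  qed simp
qed (use D kl in auto)

theorem theoremB:
  fixes n k l :: nat
  assumes "n \<ge> 3" and "k \<ge> 1" and "l \<ge> 1" and "k + l = n"
  shows "(\<forall>D :: (real ^ 2) set.
            finite D \<and> card D = n \<and> general_position_plane D \<longrightarrow>
            int (card (separable_partitions UNIV plane_circles D k l)) =
              (if k \<noteq> l then 2 * int k * int l - int k - int l + 2
               else (int k)\<^sup>2 - int k + 1)) \<and>
         (\<forall>(a :: real ^ 3) (r :: real) (D :: (real ^ 3) set).
            0 < r \<and> D \<subseteq> sphere a r \<and>
            finite D \<and> card D = n \<and> general_position_sphere a r D \<longrightarrow>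
            int (card (separable_partitions (sphere a r) (sphere_circles a r) D k l)) =
              (if k \<noteq> l then 2 * int k * int l - int k - int l + 2
               else (int k)\<^sup>2 - int k + 1))"
proof (intro conjI allI impI)
  fix D :: "(real ^ 2) set"
  assume "finite D \<and> card D = n \<and> general_position_plane D"
  then show "int (card (separable_partitions UNIV plane_circles D k l)) =
      (if k \<noteq> l then 2 * int k * int l - int k - int l + 2 else (int k)\<^sup>2 - int k + 1)"
    using assms by (intro card_separable_partitions_plane) auto
next
  fix a :: "real ^ 3" and r :: real and D :: "(real ^ 3) set"
  assume "0 < r \<and> D \<subseteq> sphere a r \<and> finite D \<and> card D = n \<and> general_position_sphere a r D"
  then show "int (card (separable_partitions (sphere a r) (sphere_circles a r) D k l)) =
      (if k \<noteq> l then 2 * int k * int l - int k - int l + 2 else (int k)\<^sup>2 - int k + 1)"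
    using assms by (intro card_separable_partitions_sphere) auto
qed

end
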